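(* Let $d_0>2$ be a given square-free integer. Set $$\kappa_{d_0}=\frac{\pi^2}{6}\prod_{q\mid d_0}\left(1-\frac1{q^2}\right),\qquad c=3\prod_{q\mid d_0}\frac{q-1}{q+1}.$$ For $n\in\mathbb Z$ set $\varepsilon(n)=+1$ if $n\equiv1\pmod{d_0}$ and $\varepsilon(n)=-1$ if $n\equiv-1\pmod{d_0}$. Then for every $f>2$ all of whose prime divisors $q$ satisfy $q\equiv\pm1\pmod{d_0}$, $$M_{d_0}(f,\{1\})=\kappa_{d_0}\left\{\prod_{q\mid f}\left(1-\frac1{q^2}\right)-\frac cf\prod_{q\mid f}\left(1-\frac1q\right)+\varepsilon(f)\frac{c-1}{f}\prod_{q\mid f}\left(1-\frac{\varepsilon(q)}{q}\right)\right\}.$$ In particular, if all prime divisors $q$ of $f>2$ satisfy $q\equiv1\pmod{d_0}$, then $$M_{d_0}(f,\{1\})=\kappa_{d_0}\left\{\prod_{q\mid f}\left(1-\frac1{q^2}\right)-\frac1f\prod_{q\mid f}\left(1-\frac1q\right)\right\}.$$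
   Context: Products over $q\mid n$ run over distinct primes dividing $n$. For $f>2$ coprime to $d_0$, $X_f^-$ is the set of odd Dirichlet characters modulo $f$; for $\chi$ modulo $f$, $\chi'$ is the character modulo $d_0f$ induced by $\chi$; $L(1,\chi')=\sum_{n\ge1}\chi'(n)/n$; and $M_{d_0}(f,\{1\})=\frac{1}{\#X_f^-}\sum_{\chi\in X_f^-}|L(1,\chi')|^2$. *)

theory Defs
  imports
    Complex_Main
    "HOL-Number_Theory.Number_Theory"
    "HOL-Computational_Algebra.Squarefree"
begin

(* Characters are functions on the integers, extended by 0 to the integers not
   coprime to the modulus. *)
definition dirichlet_character :: "nat \<Rightarrow> (int \<Rightarrow> complex) \<Rightarrow> bool" where
  "dirichlet_character m \<psi> \<longleftrightarrow>
     (\<forall>a b. \<psi> (a * b) = \<psi> a * \<psi> b) \<and>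
     (\<forall>a. \<psi> (a + int m) = \<psi> a) \<and>
     (\<forall>a. \<psi> a \<noteq> 0 \<longleftrightarrow> coprime a (int m))"

definition odd_characters :: "nat \<Rightarrow> (int \<Rightarrow> complex) set" where
  "odd_characters m = {\<psi>. dirichlet_character m \<psi> \<and> \<psi> (- 1) = - 1}"

(* Meaningful when the modulus of \<psi> divides m. *)
definition induced_character :: "nat \<Rightarrow> (int \<Rightarrow> complex) \<Rightarrow> int \<Rightarrow> complex" where
  "induced_character m \<psi> n = (if coprime n (int m) then \<psi> n else 0)"

(* For non-principal \<psi> this series converges, in general only conditionally; hence the
   ordered sum suminf. *)
definition L_at_1 :: "(int \<Rightarrow> complex) \<Rightarrow> complex" where
  "L_at_1 \<psi> = (\<Sum>n. \<psi> (int (Suc n)) / of_nat (Suc n))"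

(* The quantity M_{d0}(f, {1}). *)
definition M_trivial :: "nat \<Rightarrow> nat \<Rightarrow> real" where
  "M_trivial d0 f =
     (1 / real (card (odd_characters f))) *
     (\<Sum>\<psi>\<in>odd_characters f. (cmod (L_at_1 (induced_character (d0 * f) \<psi>)))\<^sup>2)"

definition kappa :: "nat \<Rightarrow> real" where
  "kappa d0 = pi\<^sup>2 / 6 * (\<Prod>q\<in>prime_factors d0. (1 - 1 / (real q)\<^sup>2))"

definition c_const :: "nat \<Rightarrow> real" where
  "c_const d0 = 3 * (\<Prod>q\<in>prime_factors d0. (real q - 1) / (real q + 1))"

(* The value 0 outside the classes of 1 and -1 modulo d0 is a dummy. *)
definition eps :: "nat \<Rightarrow> int \<Rightarrow> real" where
  "eps d0 n =
     (if [n = 1] (mod int d0) then 1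
      else if [n = - 1] (mod int d0) then - 1
      else 0)"

end

(* For an odd function psi of period N, L(1, psi) is (pi / 2N) times the sum of psi(b) cot(pi b / N)
   over b mod N. Writing b / (d0 f) = a / f + k / d0 modulo 1 and using orthogonality of characters,
   M_{d0}(f, {1}) becomes pi^2 / (2 d0^2 f^2) times the sum of g(a / f)^2 over the units a mod f,
   where g(y) is the sum of cot(pi (y + k / d0)) over the units k mod d0. If F = +-1 (mod d0), then
   the sum of g(a / F)^2 over all residues a mod F has a closed form: the products
   cot A cot B = cot(A - B) (cot B - cot A) - 1 reduce it to sums of cot(pi (a / F + k / d0)) over a,
   that is to F cot(pi F k / d0) = +-F cot(pi k / d0). No reciprocity law for Dedekind sums is
   needed. The closed form is a combination of F^2, F and eps(F) F, each multiplicative in F, so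
   sieving out the a not coprime to f produces the three Euler products. *)
theory Submission
  imports Defs "HOL-Analysis.Analysis" "HOL-Real_Asymp.Real_Asymp"
begin

section \<open>Cotangent sums\<close>

text \<open>Both constants of the theorem come from pairs of units k, l modulo d0. Let J be the sum
  of 1 / sin(pi k / d0)^2 over the units k, and phi their number. The closed form over all residues
  is J F^2 - phi^2 F + eps(F) (phi^2 - J) F: the diagonal pairs k = l supply J, and counting all
  pairs supplies phi^2. Since kappa = pi^2 J / (2 d0^2) and c = phi^2 / J, the coefficients 1, -c, c
  - 1 are those of the closed form divided by J. The congruence is imposed on the primes because
  sieving needs the closed form at every divisor F of f. For F = +-1 (mod d0), replacing k by F k
  changes cot(pi k / d0) at most by a sign, so the linearized products fold back into cot(pi k / d0)
  cot(pi l / d0). Summed over k and l these vanish, because the sum of cot(pi k / d0) over the units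
  is 0. For other F this folding back fails.\<close>

definition cotpi :: "real \<Rightarrow> real" where
  "cotpi x = cot (pi * x)"

lemma cotpi_minus [simp]: "cotpi (- x) = - cotpi x"
  by (simp add: cotpi_def)

lemma sin_pi_mult_eq_0_iff: "sin (pi * x) = 0 \<longleftrightarrow> x \<in> \<int>" for x :: real
  using sin_times_pi_eq_0[of x] by (simp add: mult.commute)

text \<open>The value at the poles is the default of division by zero. It lets sums over residues
  keep the residue 0.\<close>

lemma cotpi_Ints: "x \<in> \<int> \<Longrightarrow> cotpi x = 0"
  using sin_pi_mult_eq_0_iff[of x] by (simp add: cotpi_def cot_def)

lemma cotpi_plus_1: "cotpi (x + 1) = cotpi x"
  by (simp add: cotpi_def cot_def distrib_left)

lemma cotpi_add_int [simp]: "cotpi (x + of_int n) = cotpi x"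
proof (induction n rule: int_induct[where k = 0])
  case (step1 i)
  then show ?case using cotpi_plus_1[of "x + of_int i"] by (simp add: add_ac)
next
  case (step2 i)
  then show ?case using cotpi_plus_1[of "x + of_int (i - 1)"] by (simp add: add_ac)
qed auto

text \<open>The subtraction formula for the cotangent, solved for the product. It turns second
  moments of cotangents into first moments.\<close>

lemma cotpi_mult:
  assumes "x \<notin> \<int>" "y \<notin> \<int>" "x - y \<notin> \<int>"
  shows "cotpi x * cotpi y = cotpi (x - y) * (cotpi y - cotpi x) - 1"
proof -
  have s: "sin (pi * x) \<noteq> 0" "sin (pi * y) \<noteq> 0" "sin (pi * (x - y)) \<noteq> 0"
    using assms by (simp_all add: sin_pi_mult_eq_0_iff)
  have d: "sin (pi * (x - y)) = sin (pi * x) * cos (pi * y) - cos (pi * x) * sin (pi * y)"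
    by (simp add: right_diff_distrib sin_diff)
  have e: "cos (pi * (x - y)) = cos (pi * x) * cos (pi * y) + sin (pi * x) * sin (pi * y)"
    by (simp add: right_diff_distrib cos_diff)
  have "cotpi y - cotpi x = sin (pi * (x - y)) / (sin (pi * x) * sin (pi * y))"
    using s unfolding d by (simp add: cotpi_def cot_def field_simps)
  hence "cotpi (x - y) * (cotpi y - cotpi x) = cos (pi * (x - y)) / (sin (pi * x) * sin (pi * y))"
    using s(3) by (simp add: cotpi_def cot_def)
  also have "\<dots> = cotpi x * cotpi y + 1"
    using s(1,2) unfolding e by (simp add: cotpi_def cot_def field_simps)
  finally show ?thesis by simp
qed

lemma divide_notin_Ints:
  assumes "0 < a" "a < n"
  shows "real a / real n \<notin> \<int>"
proof
  assume "real a / real n \<in> \<int>"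
  hence "frac (real a / real n) = 0" by simp
  moreover have "frac (real a / real n) = real a / real n"
    using assms by (subst frac_eq) auto
  ultimately show False using assms by simp
qed

lemma divide_diff_notin_Ints:
  assumes "a < n" "b < n" "a \<noteq> b"
  shows "real a / real n - real b / real n \<notin> \<int>"
proof
  assume "real a / real n - real b / real n \<in> \<int>"
  then obtain k :: int where "real a / real n - real b / real n = of_int k"
    by (auto elim: Ints_cases)
  hence "real_of_int (int a - int b) = real_of_int (k * int n)"
    using assms by (simp add: field_simps)
  hence k: "int a - int b = k * int n" by (simp only: of_int_eq_iff)
  hence "\<bar>k * int n\<bar> < int n" using assms by linarith
  hence "k = 0" using assms by (simp add: abs_mult)
  thus False using k assms by simp
qed

lemma add_divide_notin_Ints:
  assumes "n > 0" "real n * x \<notin> \<int>"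
  shows "x + real a / real n \<notin> \<int>"
proof
  assume "x + real a / real n \<in> \<int>"
  hence "real n * (x + real a / real n) - real a \<in> \<int>" by (intro Ints_diff Ints_mult) auto
  thus False using assms by (simp add: distrib_left)
qed

section \<open>Cotangents as rational functions of roots of unity\<close>

text \<open>With w = exp(2 pi i x) the cotangent is i (w + 1) / (w - 1). It is written with w in one
  denominator only, so that sums over shifts of x become partial fraction sums.\<close>

lemma cotpi_cis:
  assumes "x \<notin> \<int>"
  shows "complex_of_real (cotpi x) = \<i> * (1 - 2 / (1 - cis (2 * pi * x)))"
proof -
  define s c where "s = sin (pi * x)" and "c = cos (pi * x)"
  have s: "s \<noteq> 0" using assms by (simp add: s_def sin_pi_mult_eq_0_iff)
  have sc: "s\<^sup>2 + c\<^sup>2 = 1" by (simp add: s_def c_def)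
  have "cis (2 * pi * x) = (cis (pi * x))\<^sup>2"
    by (simp add: Complex.DeMoivre mult_ac)
  also have "cis (pi * x) = Complex c s"
    by (simp add: cis.ctr s_def c_def)
  finally have w: "1 - cis (2 * pi * x) = Complex (2 * s\<^sup>2) (- 2 * c * s)"
    using sc by (simp add: complex_eq_iff power2_eq_square)
  have nz: "1 - cis (2 * pi * x) \<noteq> 0" using s by (simp add: w complex_eq_iff)
  have "(complex_of_real (c / s) * (1 - cis (2 * pi * x))) = \<i> * ((1 - cis (2 * pi * x)) - 2)"
    unfolding w using s sc by (simp add: complex_eq_iff power2_eq_square)
  hence "complex_of_real (c / s) = \<i> * ((1 - cis (2 * pi * x)) - 2) / (1 - cis (2 * pi * x))"
    using nz by (simp add: field_simps)
  also have "\<dots> = \<i> * (1 - 2 / (1 - cis (2 * pi * x)))"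
    using nz by (simp add: field_simps)
  finally show ?thesis by (simp add: cotpi_def cot_def s_def c_def)
qed

lemma cis_2pi_eq_1_iff: "cis (2 * pi * x) = 1 \<longleftrightarrow> x \<in> \<int>"
proof
  assume "cis (2 * pi * x) = 1"
  hence "cos (2 * pi * x) = 1" by (simp add: complex_eq_iff)
  then obtain n :: int where "2 * pi * x = of_int n * 2 * pi"
    by (auto simp: cos_one_2pi_int)
  thus "x \<in> \<int>" by auto
qed auto

text \<open>Since w^n = 1, each 1 / (1 - w z) is a geometric sum of length n divided by 1 - z^n.
  Summed over all n-th roots of unity w, only the exponent 0 survives.\<close>

lemma sum_inverse_1_minus_roots:
  assumes "n > 0" "z ^ n \<noteq> (1::complex)"
  shows "(\<Sum>a<n. 1 / (1 - cis (2 * pi * real a / real n) * z)) = of_nat n / (1 - z ^ n)"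
proof -
  define w where "w = (\<lambda>a. cis (2 * pi * real a / real n))"
  have wn: "w a ^ n = 1" for a
    using assms(1) by (simp add: w_def Complex.DeMoivre)
  have "1 / (1 - w a * z) = (\<Sum>j<n. (w a) ^ j * z ^ j) / (1 - z ^ n)" for a
  proof -
    have *: "1 - z ^ n = (1 - w a * z) * (\<Sum>j<n. (w a) ^ j * z ^ j)"
      using one_diff_power_eq[of "w a * z" n] by (simp add: power_mult_distrib wn)
    with assms(2) have "1 - w a * z \<noteq> 0" "(\<Sum>j<n. (w a) ^ j * z ^ j) \<noteq> 0" by auto
    thus ?thesis by (subst *) simp
  qed
  hence "(\<Sum>a<n. 1 / (1 - w a * z)) = (\<Sum>a<n. \<Sum>j<n. (w a) ^ j * z ^ j) / (1 - z ^ n)"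
    by (simp add: sum_divide_distrib)
  also have "(\<Sum>a<n. \<Sum>j<n. (w a) ^ j * z ^ j) = (\<Sum>j<n. (\<Sum>a<n. (w a) ^ j) * z ^ j)"
    by (subst sum.swap) (simp add: sum_distrib_right)
  also have "\<dots> = (\<Sum>j<n. if j = 0 then of_nat n else 0)"
  proof (intro sum.cong refl)
    fix j assume j: "j \<in> {..<n}"
    define u where "u = cis (2 * pi * (real j / real n))"
    have wu: "w a ^ j = u ^ a" for a
      by (simp add: w_def u_def Complex.DeMoivre mult_ac)
    show "(\<Sum>a<n. (w a) ^ j) * z ^ j = (if j = 0 then of_nat n else 0)"
    proof (cases "j = 0")
      case False
      have "real j / real n \<notin> \<int>" using False j by (intro divide_notin_Ints) auto
      hence u1: "u \<noteq> 1" unfolding u_def cis_2pi_eq_1_iff .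
      have "u ^ n = w j ^ n" by (simp add: u_def w_def)
      hence "(\<Sum>a<n. u ^ a) = 0" using u1 by (simp add: geometric_sum wn)
      thus ?thesis using False by (simp add: wu)
    qed auto
  qed
  also have "\<dots> = of_nat n" using assms(1) by (simp add: sum.delta)
  finally show ?thesis by (simp add: w_def)
qed

text \<open>The multiplication formula of the cotangent: apply the partial fraction sum to z = exp(2
  pi i x), whose n-th power belongs to n x.\<close>

lemma sum_cotpi_shift:
  assumes "n > 0" "real n * x \<notin> \<int>"
  shows "(\<Sum>a<n. cotpi (x + real a / real n)) = real n * cotpi (real n * x)"
proof -
  define z where "z = cis (2 * pi * x)"
  have zn: "z ^ n = cis (2 * pi * (real n * x))" by (simp add: z_def Complex.DeMoivre mult_ac)
  hence zn1: "z ^ n \<noteq> 1" using assms(2) cis_2pi_eq_1_iff[of "real n * x"] by simp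
  note nI = add_divide_notin_Ints[OF assms]
  have "complex_of_real (\<Sum>a<n. cotpi (x + real a / real n)) =
      (\<Sum>a<n. \<i> * (1 - 2 * (1 / (1 - cis (2 * pi * real a / real n) * z))))"
    unfolding of_real_sum
    by (intro sum.cong refl) (simp add: cotpi_cis[OF nI] z_def cis_mult algebra_simps)
  also have "\<dots> = \<i> * (of_nat n - 2 * (\<Sum>a<n. 1 / (1 - cis (2 * pi * real a / real n) * z)))"
    by (simp only: sum_distrib_left [symmetric] sum_subtractf) simp
  also have "\<dots> = of_nat n * (\<i> * (1 - 2 / (1 - z ^ n)))"
    by (subst sum_inverse_1_minus_roots[OF assms(1) zn1]) (simp add: algebra_simps)
  also have "\<dots> = complex_of_real (real n * cotpi (real n * x))"
    by (simp add: cotpi_cis[OF assms(2)] zn)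
  finally show ?thesis by (simp only: of_real_eq_iff)
qed

text \<open>Square the preceding identity: \<open>cotpi_mult\<close> linearizes the off-diagonal products,
  and the cotangents of the differences cancel because \<open>cotpi\<close> is odd.\<close>

lemma sum_cotpi_sq_shift:
  assumes "n > 0" "real n * x \<notin> \<int>"
  shows "(\<Sum>a<n. (cotpi (x + real a / real n))\<^sup>2) =
           (real n)\<^sup>2 * (1 + (cotpi (real n * x))\<^sup>2) - real n"
proof -
  define C where "C = (\<lambda>a. cotpi (x + real a / real n))"
  define D where "D = (\<lambda>a b. cotpi (real a / real n - real b / real n))"
  note nI = add_divide_notin_Ints[OF assms]
  have Csum: "(\<Sum>a<n. C a) = real n * cotpi (real n * x)"
    unfolding C_def by (rule sum_cotpi_shift[OF assms])
  \<comment> \<open>On the diagonal \<open>D a a\<close> is 0 by the default value of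
    \<open>cotpi\<close> at integers, so the added term only has to restore the square and undo the
    final -1.\<close>
  have prod: "C a * C b = D a b * C b - D a b * C a + (if a = b then 1 + (C a)\<^sup>2 else 0) - 1"
    if "a < n" "b < n" for a b
  proof (cases "a = b")
    case False
    with that have "real a / real n - real b / real n \<notin> \<int>" by (intro divide_diff_notin_Ints)
    hence "C a * C b = cotpi ((x + real a / real n) - (x + real b / real n)) * (C b - C a) - 1"
      unfolding C_def by (intro cotpi_mult nI) simp
    thus ?thesis using False by (simp add: D_def right_diff_distrib)
  qed (simp add: D_def cotpi_Ints power2_eq_square)
  have D_antisym: "D a b = - D b a" for a b
    using cotpi_minus[of "real b / real n - real a / real n"] by (simp add: D_def)
  \<comment> \<open>Translation by a permutes the residues modulo n, so the sum does not depend on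
    a; the reflection b to n - b shows that it equals its own negative.\<close>
  have D0: "(\<Sum>b<n. D b a) = 0" if "a < n" for a
  proof -
    have *: "(\<Sum>b<n. cotpi (real b / real n - real a / real n)) = 
              (\<Sum>b<n. cotpi (real b / real n))"
    proof -
      have "(\<Sum>b<n. cotpi (real b / real n - real a / real n)) = 
            (\<Sum>b<n. cotpi (real ((b + (n - a)) mod n) / real n))"
      proof (intro sum.cong refl)
        fix b assume "b \<in> {..<n}"
        have "real b / real n - real a / real n = real (b + (n - a)) / real n - 1"
          using that by (simp add: field_simps of_nat_diff)
        also have "real (b + (n - a)) / real n = 
           real ((b + (n - a)) mod n) / real n + real ((b + (n - a)) div n)"
          by (subst add.commute) (rule of_nat_of_nat_div_aux)
        finally have "real b / real n - real a / real n = real ((b + (n - a)) mod n) / real n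
             + of_int (int ((b + (n - a)) div n) - 1)" by simp
        thus "cotpi (real b / real n - real a / real n) = 
              cotpi (real ((b + (n - a)) mod n) / real n)"
          by (simp only: cotpi_add_int)
      qed
      also have "\<dots> = (\<Sum>b<n. cotpi (real b / real n))"
      proof (rule sum.reindex_bij_betw)
        have "inj_on (\<lambda>b. (b + (n - a)) mod n) {..<n}"
        proof (rule inj_onI)
          fix x y assume xy: "x \<in> {..<n}" "y \<in> {..<n}" "(x + (n - a)) mod n = (y + (n - a)) mod n"
          hence "[x + (n - a) = y + (n - a)] (mod n)" by (simp only: unique_euclidean_semiring_class.cong_def)
          hence "[x = y] (mod n)" by (simp only: cong_add_rcancel_nat)
          thus "x = y" using xy by (simp add: unique_euclidean_semiring_class.cong_def)
        qed
        moreover have "(\<lambda>b. (b + (n - a)) mod n) ` {..<n} \<subseteq> {..<n}"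
          using assms(1) by auto
        ultimately show "bij_betw (\<lambda>b. (b + (n - a)) mod n) {..<n} {..<n}"
          by (simp add: bij_betw_def endo_inj_surj)
      qed
      finally show ?thesis .
    qed
    have "(\<Sum>b<n. cotpi (real b / real n)) = (\<Sum>b\<in>{1..<n}. cotpi (real b / real n))"
      using assms(1) by (intro sum.mono_neutral_right) (auto simp: cotpi_Ints not_less_eq_eq)
    also have "\<dots> = (\<Sum>b\<in>{1..<n}. cotpi (real (n - b) / real n))"
      by (rule sum.reindex_bij_witness[of _ "\<lambda>b. n - b" "\<lambda>b. n - b"]) auto
    also have "\<dots> = (\<Sum>b\<in>{1..<n}. - cotpi (real b / real n))"
    proof (intro sum.cong refl)
      fix b assume "b \<in> {1..<n}"
      hence "real (n - b) / real n = - (real b / real n) + of_int 1"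
        by (simp add: field_simps of_nat_diff)
      thus "cotpi (real (n - b) / real n) = - cotpi (real b / real n)"
        by (simp only: cotpi_add_int cotpi_minus)
    qed
    also have "\<dots> = - (\<Sum>b\<in>{1..<n}. cotpi (real b / real n))" by (simp add: sum_negf)
    finally have "(\<Sum>b<n. cotpi (real b / real n)) = 0" 
      using \<open>(\<Sum>b<n. cotpi (real b / real n)) = (\<Sum>b\<in>{1..<n}. cotpi (real b / real n))\<close> by simp
    with * show ?thesis by (simp add: D_def)
  qed
  have D0': "(\<Sum>b<n. D a b) = 0" if "a < n" for a
  proof -
    have "(\<Sum>b<n. D a b) = (\<Sum>b<n. - D b a)" by (rule sum.cong[OF refl D_antisym])
    thus ?thesis using D0[OF that] by (simp add: sum_negf)
  qed
  have "(real n * cotpi (real n * x))\<^sup>2 = (\<Sum>a<n. \<Sum>b<n. C a * C b)"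
    by (simp add: Csum [symmetric] power2_eq_square sum_product)
  also have "\<dots> = (\<Sum>a<n. \<Sum>b<n. D a b * C b - D a b * C a + (if a = b then 1 + (C a)\<^sup>2 else 0) - 1)"
    by (intro sum.cong refl prod) auto
  also have "\<dots> = (\<Sum>a<n. \<Sum>b<n. D a b * C b) - (\<Sum>a<n. \<Sum>b<n. D a b * C a)
       + (\<Sum>a<n. \<Sum>b<n. if a = b then 1 + (C a)\<^sup>2 else 0) - (real n)\<^sup>2"
    by (simp add: sum.distrib sum_subtractf power2_eq_square[of "real n"])
  also have "(\<Sum>a<n. \<Sum>b<n. D a b * C a) = 0"
    by (simp add: sum_distrib_right [symmetric] D0')
  also have "(\<Sum>a<n. \<Sum>b<n. D a b * C b) = (\<Sum>b<n. (\<Sum>a<n. D a b) * C b)"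
    by (subst sum.swap) (simp add: sum_distrib_right)
  also have "\<dots> = 0" by (simp add: D0)
  also have "(\<Sum>a<n. \<Sum>b<n. if a = b then 1 + (C a)\<^sup>2 else 0) = real n + (\<Sum>a<n. (C a)\<^sup>2)"
    by (simp add: sum.distrib)
  finally show ?thesis by (simp add: C_def algebra_simps power_mult_distrib)
qed

lemma inverse_sin_sq:
  assumes "x \<notin> \<int>"
  shows "1 / (sin (pi * x))\<^sup>2 = 1 + (cotpi x)\<^sup>2"
proof -
  have "(1 + (cotpi x)\<^sup>2) * (sin (pi * x))\<^sup>2 = (sin (pi * x))\<^sup>2 + (cos (pi * x))\<^sup>2"
    using assms by (simp add: cotpi_def cot_def distrib_right power_divide sin_pi_mult_eq_0_iff)
  thus ?thesis using assms by (simp add: field_simps sin_pi_mult_eq_0_iff)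
qed

section \<open>Sums of inverse squared sines\<close>

text \<open>The term \<open>- real n\<close> of the cotangent version is absorbed by adding 1 to
  each of the n squares.\<close>

lemma sum_inverse_sin_sq_shift:
  assumes "n > 0" "real n * x \<notin> \<int>"
  shows "(\<Sum>a<n. 1 / (sin (pi * (x + real a / real n)))\<^sup>2) = (real n)\<^sup>2 / (sin (pi * (real n * x)))\<^sup>2"
proof -
  note nI = add_divide_notin_Ints[OF assms]
  have "(\<Sum>a<n. 1 / (sin (pi * (x + real a / real n)))\<^sup>2)
     = real n + (\<Sum>a<n. (cotpi (x + real a / real n))\<^sup>2)"
    by (simp add: inverse_sin_sq nI sum.distrib)
  also have "\<dots> = (real n)\<^sup>2 * (1 / (sin (pi * (real n * x)))\<^sup>2)"
    unfolding sum_cotpi_sq_shift[OF assms] inverse_sin_sq[OF assms(2)] by simp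
  finally show ?thesis by simp
qed

text \<open>Let x tend to 0 from the right in the shifted identity. The term a = 0 has a pole that
  cancels the pole of the right-hand side, and the constant term 1/3 of 1 / sin(y)^2 - 1 / y^2
  leaves n^2 / 3 - 1 / 3.\<close>

lemma sum_inverse_sin_sq:
  assumes "n > 0"
  shows "(\<Sum>a<n. 1 / (sin (pi * (real a / real n)))\<^sup>2) = ((real n)\<^sup>2 - 1) / 3"
proof -
  define S where "S = (\<lambda>x. \<Sum>a\<in>{1..<n}. 1 / (sin (pi * (x + real a / real n)))\<^sup>2)"
  have c: "isCont S 0" unfolding S_def
  proof (intro continuous_intros)
    fix a assume a: "a \<in> {1..<n}"
    have "real a / real n \<notin> \<int>" using a by (intro divide_notin_Ints) auto
    hence "sin (pi * (real a / real n)) \<noteq> 0" by (subst sin_pi_mult_eq_0_iff)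
    thus "(sin (pi * (0 + real a / real n)))\<^sup>2 \<noteq> 0" by simp
  qed
  hence "(S \<longlongrightarrow> S 0) (at_right 0)"
    unfolding isCont_def by (rule filterlim_mono) (auto simp: at_le)
  moreover have "eventually (\<lambda>x. S x = (real n)\<^sup>2 / (sin (pi * (real n * x)))\<^sup>2 - 1 / (sin (pi * x))\<^sup>2) (at_right 0)"
    unfolding eventually_at_right_field
  \<comment> \<open>For 0 < x < 1 / n the number n x lies strictly between 0 and 1, so the shifted
    identity applies.\<close>
  proof (intro exI[of _ "1 / real n"] conjI allI impI)
    fix x :: real assume x: "x > 0" "x < 1 / real n"
    have "real n * x \<notin> \<int>"
    proof
      assume "real n * x \<in> \<int>"
      hence "frac (real n * x) = 0" by simp
      moreover have "frac (real n * x) = real n * x"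
        using x assms by (subst frac_eq) (auto simp: field_simps)
      ultimately show False using x assms by simp
    qed
    note sum_inverse_sin_sq_shift[OF assms this]
    moreover have "(\<Sum>a<n. 1 / (sin (pi * (x + real a / real n)))\<^sup>2) = 1 / (sin (pi * x))\<^sup>2 + S x"
    proof -
      have "{..<n} = insert 0 {1..<n}" using assms by auto
      thus ?thesis by (simp add: S_def)
    qed
    ultimately show "S x = (real n)\<^sup>2 / (sin (pi * (real n * x)))\<^sup>2 - 1 / (sin (pi * x))\<^sup>2"
      by simp
  qed (use assms in auto)
  ultimately have 1: "((\<lambda>x. (real n)\<^sup>2 / (sin (pi * (real n * x)))\<^sup>2 - 1 / (sin (pi * x))\<^sup>2) \<longlongrightarrow> S 0) (at_right 0)"
    by (rule Lim_transform_eventually)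
  have n0: "real n > 0" using assms by simp
  define g where "g = (\<lambda>y::real. 1 / (sin y)\<^sup>2 - 1 / y\<^sup>2)"
  have g: "(g \<longlongrightarrow> 1 / 3) (at_right 0)" unfolding g_def by real_asymp
  have "filterlim (\<lambda>x. pi * (real n * x)) (at_right 0) (at_right 0)"
    "filterlim (\<lambda>x. pi * x) (at_right 0) (at_right 0)"
    using n0 by real_asymp+
  note lims = this[THEN filterlim_compose[OF g]]
  have "((\<lambda>x. (real n)\<^sup>2 * g (pi * (real n * x)) - g (pi * x)) \<longlongrightarrow>
      (real n)\<^sup>2 * (1 / 3) - 1 / 3) (at_right 0)"
    by (intro tendsto_diff tendsto_mult tendsto_const lims)
  \<comment> \<open>The subtracted poles agree: n^2 / (pi n x)^2 = 1 / (pi x)^2.\<close>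
  moreover have "(real n)\<^sup>2 * g (pi * (real n * x)) - g (pi * x) =
      (real n)\<^sup>2 / (sin (pi * (real n * x)))\<^sup>2 - 1 / (sin (pi * x))\<^sup>2" for x
    using n0 by (simp add: g_def right_diff_distrib power_mult_distrib)
  ultimately have "((\<lambda>x. (real n)\<^sup>2 / (sin (pi * (real n * x)))\<^sup>2 - 1 / (sin (pi * x))\<^sup>2) \<longlongrightarrow> ((real n)\<^sup>2 - 1) / 3) (at_right 0)"
    by (simp add: diff_divide_distrib)
  hence "S 0 = ((real n)\<^sup>2 - 1) / 3" using 1 tendsto_unique trivial_limit_at_right_real by blast
  \<comment> \<open>The term a = 0 of the sum is 1 / 0 = 0, so dropping it changes nothing.\<close>
  moreover have "(\<Sum>a<n. 1 / (sin (pi * (real a / real n)))\<^sup>2) = S 0"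
  proof -
    have "{..<n} = insert 0 {1..<n}" using assms by auto
    thus ?thesis by (simp add: S_def)
  qed
  ultimately show ?thesis by simp
qed

section \<open>The value at 1 of the L-series of an odd periodic function\<close>

text \<open>Differentiate Euler's reflection formula in the form
  \<open>rGamma z * rGamma (1 - z)\<close> = sin(pi z) / pi. The computation is complex and is
  restricted to real arguments at the end.\<close>

lemma Digamma_reflection:
  fixes x :: real
  assumes "x \<notin> \<int>"
  shows "Digamma (1 - x) - Digamma x = pi * cotpi x"
proof -
  define z where "z = complex_of_real x"
  have zI: "z \<notin> \<int>" "1 - z \<notin> \<int>"
    using assms Ints_diff[of 1 "1 - z"] by (auto simp: z_def)
  hence z: "z \<notin> \<int>\<^sub>\<le>\<^sub>0" "1 - z \<notin> \<int>\<^sub>\<le>\<^sub>0" by (auto dest: nonpos_Ints_Int)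
  have "((\<lambda>z. rGamma z * rGamma (1 - z)) has_field_derivative
      (- rGamma z * Digamma z) * rGamma (1 - z) + rGamma z * (rGamma (1 - z) * Digamma (1 - z))) (at z)"
    by (rule derivative_eq_intros refl has_field_derivative_rGamma_no_nonpos_int z
          has_field_derivative_rGamma_no_nonpos_int[THEN DERIV_chain2])+ simp
  moreover have "((\<lambda>z. rGamma z * rGamma (1 - z)) has_field_derivative cos (of_real pi * z)) (at z)"
    unfolding rGamma_reflection_complex by (rule derivative_eq_intros refl | simp)+
  ultimately have "(- rGamma z * Digamma z) * rGamma (1 - z) + rGamma z * (rGamma (1 - z) * Digamma (1 - z))
      = cos (of_real pi * z)" by (rule DERIV_unique)
  hence "(rGamma z * rGamma (1 - z)) * (Digamma (1 - z) - Digamma z) = cos (of_real pi * z)"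
    by (simp add: algebra_simps)
  hence "sin (of_real pi * z) * (Digamma (1 - z) - Digamma z) = of_real pi * cos (of_real pi * z)"
    unfolding rGamma_reflection_complex by (simp add: field_simps)
  moreover have "Digamma z = of_real (Digamma x)"
    using assms unfolding z_def by (subst Polygamma_of_real) auto
  moreover have "Digamma (1 - z) = of_real (Digamma (1 - x))"
  proof -
    have "x \<noteq> 1" using assms by auto
    thus ?thesis using Polygamma_of_real[of "1 - x" 0, where 'a = complex] by (simp add: z_def)
  qed
  ultimately have "complex_of_real (sin (pi * x) * (Digamma (1 - x) - Digamma x)) = of_real (pi * cos (pi * x))"
    by (simp add: z_def sin_of_real [symmetric] cos_of_real [symmetric])
  hence "sin (pi * x) * (Digamma (1 - x) - Digamma x) = pi * cos (pi * x)"
    by (simp only: of_real_eq_iff)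
  moreover have "sin (pi * x) \<noteq> 0" using assms by (simp add: sin_pi_mult_eq_0_iff)
  ultimately show ?thesis by (simp add: cotpi_def cot_def field_simps)
qed

text \<open>A partial sum differs from the sum over its complete blocks by fewer than N terms, whose
  indices tend to infinity. This permits evaluating a conditionally convergent L-series along
  multiples of its period.\<close>

lemma sums_blocks:
  fixes f :: "nat \<Rightarrow> 'a :: real_normed_vector"
  assumes "N > 0" "f \<longlonglongrightarrow> 0" "(\<lambda>K. \<Sum>i<K*N. f i) \<longlonglongrightarrow> s"
  shows "f sums s"
proof -
  define R where "R = (\<lambda>n. \<Sum>j<N. norm (f ((n div N) * N + j)))"
  have "filterlim (\<lambda>n. (n div N) * N + j) at_top sequentially" for j
  proof (rule filterlim_at_top_mono)
    show "filterlim (\<lambda>n. n div N) at_top sequentially"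
      by (rule filterlim_at_top_div_const_nat[OF assms(1)])
    show "\<forall>\<^sub>F n in sequentially. n div N \<le> n div N * N + j"
      using assms(1) by (intro always_eventually allI) (simp add: trans_le_add1)
  qed
  hence "(\<lambda>n. norm (f ((n div N) * N + j))) \<longlonglongrightarrow> 0" for j
    using filterlim_compose[OF assms(2)] tendsto_norm_zero by blast
  hence "R \<longlonglongrightarrow> (\<Sum>j<N. 0)" unfolding R_def by (intro tendsto_sum) 
  hence R0: "R \<longlonglongrightarrow> 0" by simp
  have "norm ((\<Sum>i<n. f i) - (\<Sum>i<(n div N)*N. f i)) \<le> R n" for n
  proof -
    have un: "{..<n} = {..<(n div N)*N} \<union> {(n div N)*N..<n}"
      by (auto intro: less_le_trans[OF _ div_times_less_eq_dividend])
    have "(\<Sum>i<n. f i) = (\<Sum>i<(n div N)*N. f i) + (\<Sum>i\<in>{(n div N)*N..<n}. f i)"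
      by (subst un) (rule sum.union_disjoint, auto)
    also have "(\<Sum>i\<in>{(n div N)*N..<n}. f i) = (\<Sum>j<n mod N. f ((n div N) * N + j))"
      by (rule sum.reindex_bij_witness[of _ "\<lambda>j. (n div N) * N + j" "\<lambda>i. i - (n div N) * N"])
         (auto simp: minus_div_mult_eq_mod [symmetric])
    finally have "norm ((\<Sum>i<n. f i) - (\<Sum>i<(n div N)*N. f i)) =
        norm (\<Sum>j<n mod N. f ((n div N) * N + j))" by simp
    also have "\<dots> \<le> (\<Sum>j<n mod N. norm (f ((n div N) * N + j)))" by (rule norm_sum)
    also have "\<dots> \<le> R n" unfolding R_def
      using assms(1) by (intro sum_mono2) (auto intro: less_trans[OF _ mod_less_divisor])
    finally show ?thesis .
  qed
  hence "(\<lambda>n. (\<Sum>i<n. f i) - (\<Sum>i<(n div N)*N. f i)) \<longlonglongrightarrow> 0"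
    by (intro Lim_null_comparison[OF _ R0] always_eventually allI)
  moreover have "(\<lambda>n. \<Sum>i<(n div N)*N. f i) \<longlonglongrightarrow> s"
    by (rule filterlim_compose[OF assms(3) filterlim_at_top_div_const_nat[OF assms(1)]])
  ultimately have "(\<lambda>n. ((\<Sum>i<n. f i) - (\<Sum>i<(n div N)*N. f i)) + (\<Sum>i<(n div N)*N. f i)) \<longlonglongrightarrow> 0 + s"
    by (rule tendsto_add)
  thus ?thesis by (simp add: sums_def)
qed

lemma periodic_int:
  fixes \<psi> :: "int \<Rightarrow> 'a"
  assumes "\<And>a. \<psi> (a + m) = \<psi> a"
  shows "\<psi> (a + k * m) = \<psi> a"
proof (induction k rule: int_induct[where k = 0])
  case (step1 i)
  then show ?case using assms[of "a + i * m"] by (simp add: algebra_simps)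
next
  case (step2 i)
  then show ?case using assms[of "a + (i - 1) * m"] by (simp add: algebra_simps)
qed auto

lemma periodic_cong:
  fixes \<psi> :: "int \<Rightarrow> 'a"
  assumes "\<And>a. \<psi> (a + m) = \<psi> a" "[a = b] (mod m)"
  shows "\<psi> a = \<psi> b"
proof -
  from assms(2) obtain k where "b = a + m * k" by (auto simp: cong_iff_lin)
  thus ?thesis using periodic_int[of \<psi> m a k] assms(1) by (simp add: mult.commute)
qed

text \<open>Split the series into residue classes modulo N. Each class diverges like (1 / N) ln K,
  but these parts cancel because the values over one period add up to 0. What remains are values of
  \<open>Digamma\<close> at a / N; oddness pairs a with N - a, and reflection turns the difference
  into a cotangent.\<close>

lemma L_at_1_odd_periodic:
  assumes N: "N > 0"
    and per: "\<And>a. \<psi> (a + int N) = \<psi> a"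
    and odd: "\<And>a. \<psi> (- a) = - \<psi> a"
  shows "L_at_1 \<psi> = of_real (pi / (2 * real N)) * (\<Sum>a<N. \<psi> (int a) * of_real (cotpi (real a / real N)))"
proof -
  define f where "f = (\<lambda>n. \<psi> (int (Suc n)) / of_nat (Suc n))"
  have \<psi>0: "\<psi> 0 = 0" using odd[of 0] by simp
  have \<psi>_refl: "\<psi> (int (N - a)) = - \<psi> (int a)" if "a \<le> N" for a
    using per[of "- int a"] odd[of "int a"] that by (simp add: of_nat_diff)
  have \<psi>N: "\<psi> (int N) = 0" using per[of 0] \<psi>0 by simp
  \<comment> \<open>The series runs through the residues 1 to N of a period; a summand vanishing at
    N may be dropped.\<close>
  have shift: "(\<Sum>a<N. g (Suc a)) = (\<Sum>a\<in>{1..<N}. g a)" if "g N = 0" for g :: "nat \<Rightarrow> complex"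
  proof -
    have "(\<Sum>a<N. g (Suc a)) = (\<Sum>a\<in>{1..N}. g a)"
      by (rule sum.reindex_bij_witness[of _ "\<lambda>b. b - 1" Suc]) auto
    also have "\<dots> = (\<Sum>a\<in>{1..<N}. g a)"
      using that N by (intro sum.mono_neutral_right) (auto simp: not_less)
    finally show ?thesis .
  qed
  have flip: "(\<Sum>a\<in>{1..<N}. g (N - a)) = (\<Sum>a\<in>{1..<N}. g a)" for g :: "nat \<Rightarrow> complex"
    by (rule sum.reindex_bij_witness[of _ "\<lambda>b. N - b" "\<lambda>b. N - b"]) auto
  have sum0: "(\<Sum>a<N. \<psi> (int (Suc a))) = 0"
  proof -
    have "(\<Sum>a\<in>{1..<N}. \<psi> (int a)) = (\<Sum>a\<in>{1..<N}. - \<psi> (int a))"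
      by (subst flip [symmetric], intro sum.cong) (use \<psi>_refl in \<open>auto simp del: of_nat_diff\<close>)
    hence "(\<Sum>a\<in>{1..<N}. \<psi> (int a)) = 0" by (simp add: sum_negf)
    thus ?thesis using shift[of "\<lambda>a. \<psi> (int a)"] \<psi>N by simp
  qed
  have "finite (range \<psi>)"
  proof (rule finite_subset)
    show "range \<psi> \<subseteq> \<psi> ` {0..<int N}"
    proof clarify
      fix a
      have "\<psi> a = \<psi> (a mod int N)" by (rule periodic_cong[where m = "int N"], rule per) (simp add: unique_euclidean_semiring_class.cong_def)
      thus "\<psi> a \<in> \<psi> ` {0..<int N}" using N by auto
    qed
  qed auto
  hence "bounded (range \<psi>)" by (rule finite_imp_bounded)
  then obtain C where C: "\<And>a. norm (\<psi> a) \<le> C" by (auto simp: bounded_iff)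
  have f0: "f \<longlonglongrightarrow> 0"
  proof (rule Lim_null_comparison)
    show "\<forall>\<^sub>F n in sequentially. norm (f n) \<le> C * inverse (real (Suc n))"
    proof (intro always_eventually allI)
      fix n
      have "norm (f n) = norm (\<psi> (int (Suc n))) * inverse (real (Suc n))"
        unfolding f_def norm_divide norm_of_nat by (rule divide_inverse)
      also have "\<dots> \<le> C * inverse (real (Suc n))" by (intro mult_right_mono C) simp
      finally show "norm (f n) \<le> C * inverse (real (Suc n))" .
    qed
    show "(\<lambda>n. C * inverse (real (Suc n))) \<longlonglongrightarrow> 0"
      by (rule tendsto_mult_right_zero) (rule LIMSEQ_inverse_real_of_nat)
  qed
  define z where "z = (\<lambda>a. of_nat (Suc a) / (of_nat N :: complex))"
  \<comment> \<open>The logarithm is inserted at no cost, by \<open>sum0\<close>. It is the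
    renormalization with which each inner sum converges to minus \<open>Digamma\<close>.\<close>
  have block: "(\<Sum>i<K*N. f i) =
     - (\<Sum>a<N. \<psi> (int (Suc a)) * (of_real (ln (real K)) - (\<Sum>k<K. inverse (z a + of_nat k)))) / of_nat N" for K
  proof -
    have "(\<Sum>i<K*N. f i) = (\<Sum>k<K. \<Sum>i\<in>{k*N..<k*N+N}. f i)"
      by (rule sum.nat_group [symmetric])
    also have "\<dots> = (\<Sum>k<K. \<Sum>a<N. f (k*N+a))"
    proof (rule sum.cong[OF refl])
      fix k
      show "(\<Sum>i\<in>{k*N..<k*N+N}. f i) = (\<Sum>a<N. f (k*N+a))"
        by (rule sum.reindex_bij_witness[of _ "\<lambda>a. k * N + a" "\<lambda>i. i - k * N"]) auto
    qed
    also have "\<dots> = (\<Sum>a<N. \<Sum>k<K. f (k*N+a))" by (rule sum.swap)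
    also have "\<dots> = (\<Sum>a<N. \<psi> (int (Suc a)) * (\<Sum>k<K. inverse (z a + of_nat k))) / of_nat N"
      unfolding sum_divide_distrib sum_distrib_left
    proof (intro sum.cong refl)
      fix a k
      have 1: "\<psi> (int (Suc (k * N + a))) = \<psi> (int (Suc a))"
        using periodic_int[of \<psi> "int N" "int (Suc a)" "int k"] per by (simp add: algebra_simps)
      have 2: "of_nat (Suc (k * N + a)) = (of_nat N :: complex) * (z a + of_nat k)"
        using N by (simp add: z_def field_simps)
      show "f (k*N+a) = \<psi> (int (Suc a)) * inverse (z a + of_nat k) / of_nat N"
        unfolding f_def 1 2 by (simp add: field_simps)
    qed
    also have "\<dots> = - (\<Sum>a<N. \<psi> (int (Suc a)) * (of_real (ln (real K)) - (\<Sum>k<K. inverse (z a + of_nat k)))) / of_nat N"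
      by (simp add: right_diff_distrib sum_subtractf sum_distrib_right [symmetric] sum0 del: of_nat_Suc)
    finally show ?thesis .
  qed
  have lim: "(\<lambda>K. \<Sum>i<K*N. f i) \<longlonglongrightarrow> - (\<Sum>a<N. \<psi> (int (Suc a)) * Digamma (z a)) / of_nat N"
    unfolding block
    by (intro tendsto_intros Digamma_LIMSEQ) (use N in \<open>auto simp: z_def simp del: of_nat_Suc\<close>)
  hence "f sums (- (\<Sum>a<N. \<psi> (int (Suc a)) * Digamma (z a)) / of_nat N)"
    by (rule sums_blocks[OF N f0])
  hence "L_at_1 \<psi> = - (\<Sum>a<N. \<psi> (int (Suc a)) * Digamma (z a)) / of_nat N"
    unfolding L_at_1_def f_def by (rule sums_unique [symmetric])
  also have "(\<Sum>a<N. \<psi> (int (Suc a)) * Digamma (z a)) =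
     (\<Sum>a\<in>{1..<N}. \<psi> (int a) * of_real (Digamma (real a / real N)))"
  proof -
    have "Digamma (z a) = of_real (Digamma (real (Suc a) / real N))" for a
      using N Polygamma_of_real[of "real (Suc a) / real N" 0, where 'a = complex]
      by (simp add: z_def del: of_nat_Suc)
    thus ?thesis using shift[of "\<lambda>a. \<psi> (int a) * of_real (Digamma (real a / real N))"] \<psi>N by simp
  qed
  also have "\<dots> = - (\<Sum>a\<in>{1..<N}. \<psi> (int a) * of_real (pi * cotpi (real a / real N))) / 2"
  proof -
    \<comment> \<open>Adding the sum to its reflection doubles it, and the sign change of
      \<open>\<psi>\<close> makes the two \<open>Digamma\<close> values enter as a
      difference.\<close>
    define D where "D = (\<lambda>a. \<psi> (int a) * of_real (Digamma (real a / real N)))"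
    have "(\<Sum>a\<in>{1..<N}. D a) + (\<Sum>a\<in>{1..<N}. D (N - a)) =
       (\<Sum>a\<in>{1..<N}. - (\<psi> (int a) * of_real (pi * cotpi (real a / real N))))"
      unfolding sum.distrib [symmetric]
    proof (intro sum.cong refl)
      fix a assume a: "a \<in> {1..<N}"
      have "real a / real N \<notin> \<int>" using a by (intro divide_notin_Ints) auto
      from Digamma_reflection[OF this]
      have "Digamma (real (N - a) / real N) = Digamma (real a / real N) + pi * cotpi (real a / real N)"
        using a by (simp add: of_nat_diff diff_divide_distrib)
      thus "D a + D (N - a) = - (\<psi> (int a) * of_real (pi * cotpi (real a / real N)))"
        using a \<psi>_refl[of a] by (simp add: D_def algebra_simps)
    qed
    hence "2 * (\<Sum>a\<in>{1..<N}. D a) = - (\<Sum>a\<in>{1..<N}. \<psi> (int a) * of_real (pi * cotpi (real a / real N)))"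
      by (simp only: flip sum_negf mult_2)
    moreover have "2 * x = - y \<Longrightarrow> x = - y / 2" for x y :: complex
      by (simp add: field_simps)
    ultimately show ?thesis unfolding D_def by blast
  qed
  also have "(\<Sum>a\<in>{1..<N}. \<psi> (int a) * of_real (pi * cotpi (real a / real N))) =
     of_real pi * (\<Sum>a<N. \<psi> (int a) * of_real (cotpi (real a / real N)))"
    unfolding sum_distrib_left using N \<psi>0
    by (intro sum.mono_neutral_cong_left) (auto simp: mult_ac not_less_eq_eq)
  finally show ?thesis by simp
qed

section \<open>Characters modulo m\<close>

lemma dirichlet_character_mult: "dirichlet_character m \<psi> \<Longrightarrow> \<psi> (a * b) = \<psi> a * \<psi> b"
  by (simp add: dirichlet_character_def)

lemma dirichlet_character_periodic: "dirichlet_character m \<psi> \<Longrightarrow> \<psi> (a + int m) = \<psi> a"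
  by (simp add: dirichlet_character_def)

lemma dirichlet_character_eq_0_iff: "dirichlet_character m \<psi> \<Longrightarrow> \<psi> a = 0 \<longleftrightarrow> \<not> coprime a (int m)"
  by (auto simp: dirichlet_character_def)

lemma dirichlet_character_cong:
  assumes "dirichlet_character m \<psi>" "[a = b] (mod int m)"
  shows "\<psi> a = \<psi> b"
  by (rule periodic_cong[where m = "int m"]) (use assms dirichlet_character_periodic in auto)

lemma dirichlet_character_1:
  assumes "dirichlet_character m \<psi>"
  shows "\<psi> 1 = 1"
  using dirichlet_character_mult[OF assms, of 1 1] dirichlet_character_eq_0_iff[OF assms, of 1] by simp

lemma dirichlet_character_power:
  assumes "dirichlet_character m \<psi>"
  shows "\<psi> (a ^ n) = \<psi> a ^ n"
  by (induction n) (simp_all add: dirichlet_character_1[OF assms] dirichlet_character_mult[OF assms])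

lemma euler_theorem_int:
  fixes a :: int
  assumes "m > 0" "coprime a (int m)"
  shows "[a ^ totient m = 1] (mod int m)"
proof -
  have r: "[a = int (nat (a mod int m))] (mod int m)" using assms(1) by simp
  hence "coprime (int (nat (a mod int m))) (int m)"
    using assms(2) coprime_cong_cong_left[OF r] by blast
  hence "coprime (nat (a mod int m)) m" by (simp only: coprime_int_iff)
  hence "[nat (a mod int m) ^ totient m = 1] (mod m)" by (rule euler_theorem)
  hence "[int (nat (a mod int m)) ^ totient m = 1] (mod int m)"
    by (metis cong_int_iff of_nat_1 of_nat_power)
  with cong_pow[OF r, of "totient m"] show ?thesis by (rule cong_trans)
qed

lemma norm_dirichlet_character:
  assumes "dirichlet_character m \<psi>" "m > 0" "coprime a (int m)"
  shows "norm (\<psi> a) = 1"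
proof -
  have "\<psi> a ^ totient m = 1"
    using dirichlet_character_cong[OF assms(1) euler_theorem_int[OF assms(2,3)]]
    by (simp add: dirichlet_character_power[OF assms(1)] dirichlet_character_1[OF assms(1)])
  hence "norm (\<psi> a) ^ totient m = 1" by (simp flip: norm_power)
  thus ?thesis using assms(2) power_eq_1_iff[of "norm (\<psi> a)" "totient m"] by simp
qed

text \<open>A character of a subgroup of the unit group modulo \<open>m\<close>; the subgroup is given as the set
  \<open>H\<close> of all integer representatives, and being finite it need not be assumed closed under inverses.\<close>

definition partial_char :: "nat \<Rightarrow> int set \<Rightarrow> (int \<Rightarrow> complex) \<Rightarrow> bool" where
  "partial_char m H \<xi> \<longleftrightarrow> 1 \<in> H \<and> (\<forall>a\<in>H. coprime a (int m)) \<and>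
     (\<forall>a\<in>H. \<forall>b. [a = b] (mod int m) \<longrightarrow> b \<in> H \<and> \<xi> b = \<xi> a) \<and>
     (\<forall>a\<in>H. \<forall>b\<in>H. a * b \<in> H \<and> \<xi> (a * b) = \<xi> a * \<xi> b) \<and> (\<forall>a\<in>H. \<xi> a \<noteq> 0)"

lemma partial_charD:
  assumes "partial_char m H \<xi>"
  shows "1 \<in> H" "a \<in> H \<Longrightarrow> coprime a (int m)" "a \<in> H \<Longrightarrow> [a = b] (mod int m) \<Longrightarrow> b \<in> H"
    "a \<in> H \<Longrightarrow> [a = b] (mod int m) \<Longrightarrow> \<xi> b = \<xi> a" "a \<in> H \<Longrightarrow> b \<in> H \<Longrightarrow> a * b \<in> H"
    "a \<in> H \<Longrightarrow> b \<in> H \<Longrightarrow> \<xi> (a * b) = \<xi> a * \<xi> b" "a \<in> H \<Longrightarrow> \<xi> a \<noteq> 0"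
  using assms unfolding partial_char_def by blast+

text \<open>This is closure under division: by Euler's theorem the power
  \<open>h ^ (totient m - 1)\<close> is an inverse of \<open>h\<close> modulo \<open>m\<close>, and
  powers stay in \<open>H\<close>.\<close>

lemma partial_char_cancel:
  assumes "partial_char m H \<xi>" "m > 0" "h \<in> H" "h' \<in> H" "[h * x = h'] (mod int m)"
  shows "x \<in> H"
proof -
  note D = partial_charD[OF assms(1)]
  have pow: "h ^ k \<in> H" for k using D(1) D(5)[OF assms(3)] by (induction k) auto
  have "h ^ (totient m - 1) * h = h ^ totient m"
    using assms(2) by (metis power_minus_mult totient_gt_0_iff)
  hence "[h ^ (totient m - 1) * h = 1] (mod int m)"
    using euler_theorem_int[OF assms(2) D(2)[OF assms(3)]] by simp
  hence "[h ^ (totient m - 1) * h * x = 1 * x] (mod int m)" by (rule cong_mult) simp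
  moreover have "[h ^ (totient m - 1) * (h * x) = h ^ (totient m - 1) * h'] (mod int m)"
    by (rule cong_mult[OF cong_refl assms(5)])
  ultimately have "[h ^ (totient m - 1) * h' = x] (mod int m)"
    by (metis cong_sym cong_trans mult.assoc mult_1)
  thus ?thesis using D(3)[OF D(5)[OF pow assms(4)]] by blast
qed

text \<open>Adjoin \<open>a\<close> to the subgroup. Here \<open>n\<close> is the order of
  \<open>a\<close> relative to \<open>H\<close>, and every n-th root of \<open>\<xi> (a ^ n)\<close>
  is an admissible value at \<open>a\<close>. That freedom is what later separates elements.\<close>

lemma partial_char_extend:
  assumes pc: "partial_char m H \<xi>" and m: "m > 0" and a: "coprime a (int m)"
    and n: "n > 0" "a ^ n \<in> H" "\<And>k. 0 < k \<Longrightarrow> k < n \<Longrightarrow> a ^ k \<notin> H" and w: "w ^ n = \<xi> (a ^ n)"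
  shows "\<exists>H' \<xi>'. partial_char m H' \<xi>' \<and> insert a H \<subseteq> H' \<and> (\<forall>x\<in>H. \<xi>' x = \<xi> x) \<and> \<xi>' a = w"
proof -
  note D = partial_charD[OF pc]
  have powH: "(a ^ n) ^ q \<in> H \<and> \<xi> ((a ^ n) ^ q) = w ^ (n * q)" for q
  proof (induction q)
    case 0
    have "\<xi> 1 = 1" using D(6)[OF D(1) D(1)] D(7)[OF D(1)] by simp
    thus ?case using D(1) by simp
  next
    case (Suc q)
    thus ?case using D(5,6)[OF n(2), of "(a ^ n) ^ q"] w by (simp add: power_add)
  qed
  \<comment> \<open>If \<open>a ^ k\<close> lies in \<open>H\<close>, so does
    \<open>a ^ (k mod n)\<close>; by minimality of \<open>n\<close> the remainder is 0.\<close>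
  have pw: "\<xi> (a ^ k) = w ^ k" if "a ^ k \<in> H" for k
  proof -
    have eq: "a ^ k = (a ^ n) ^ (k div n) * a ^ (k mod n)"
      by (simp flip: power_mult power_add)
    have "a ^ (k mod n) \<in> H"
      by (rule partial_char_cancel[OF pc m, of "(a ^ n) ^ (k div n)" "a ^ k"])
         (use powH that in \<open>auto simp flip: eq\<close>)
    hence "k mod n = 0" using n(1) n(3)[of "k mod n"] by (metis gr0I mod_less_divisor)
    hence "k = n * (k div n)" by auto
    thus ?thesis using powH[of "k div n"] by (metis power_mult)
  qed
  have w0: "w \<noteq> 0" using w n(1) D(7)[OF n(2)] by (auto simp: power_0_left)
  \<comment> \<open>Two representations of one class differ by a power of \<open>a\<close> lying in
    \<open>H\<close>, where \<open>pw\<close> fixes the value. Only natural exponents occur, hence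
    \<open>i \<le> j\<close> here and the symmetric version below.\<close>
  have wd: "\<xi> h * w ^ i = \<xi> h' * w ^ j"
    if h: "h \<in> H" "h' \<in> H" and c: "[h * a ^ i = h' * a ^ j] (mod int m)" and ij: "i \<le> j" for h h' i j
  proof -
    have "[h * a ^ i = (h' * a ^ (j - i)) * a ^ i] (mod int m)"
      using c ij by (simp add: mult.assoc flip: power_add)
    moreover have "coprime (a ^ i) (int m)" using a by simp
    ultimately have c': "[h = h' * a ^ (j - i)] (mod int m)"
      by (simp add: cong_mult_rcancel)
    have aH: "a ^ (j - i) \<in> H" by (rule partial_char_cancel[OF pc m h(2,1) cong_sym[OF c']])
    have "\<xi> h = \<xi> h' * w ^ (j - i)"
      using D(4)[OF h(1) c'] D(6)[OF h(2) aH] pw[OF aH] by simp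
    thus ?thesis using ij by (simp flip: power_add)
  qed
  have wd': "\<xi> h * w ^ i = \<xi> h' * w ^ j"
    if h: "h \<in> H" "h' \<in> H" and c: "[h * a ^ i = h' * a ^ j] (mod int m)" for h h' i j
    using wd[OF h c] wd[OF h(2,1) cong_sym[OF c]] by (cases "i \<le> j") auto
  \<comment> \<open>The pair (h, i) represents the class of h a^i. The extension picks some
    representation, and \<open>val\<close> shows that the choice is irrelevant.\<close>
  define R where "R = (\<lambda>x p. fst p \<in> H \<and> [x = fst p * a ^ snd p] (mod int m))"
  define H' where "H' = {x. \<exists>p. R x p}"
  define \<xi>' where "\<xi>' = (\<lambda>x. let p = (SOME p. R x p) in \<xi> (fst p) * w ^ snd p)"
  have val: "\<xi>' x = \<xi> h * w ^ i" if "h \<in> H" "[x = h * a ^ i] (mod int m)" for x h i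
  proof -
    have "R x (h, i)" using that by (simp add: R_def)
    hence "R x (SOME p. R x p)" by (rule someI)
    thus ?thesis unfolding \<xi>'_def Let_def R_def using wd' that by (meson cong_sym cong_trans)
  qed
  have mem: "x \<in> H'" if "h \<in> H" "[x = h * a ^ i] (mod int m)" for x h i
    using that unfolding H'_def R_def by auto
  have H'E: "\<exists>h i. h \<in> H \<and> [x = h * a ^ i] (mod int m)" if "x \<in> H'" for x
    using that unfolding H'_def R_def by auto
  have H: "x \<in> H' \<and> \<xi>' x = \<xi> x" if "x \<in> H" for x
    using mem[of x x 0] val[of x x 0] that by simp
  have aa: "a \<in> H' \<and> \<xi>' a = w"
  proof -
    have "\<xi> 1 = 1" using D(6)[OF D(1) D(1)] D(7)[OF D(1)] by simp
    thus ?thesis using mem[of 1 a 1] val[of 1 a 1] D(1) by simp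
  qed
  have "partial_char m H' \<xi>'" unfolding partial_char_def
  proof (intro conjI ballI allI impI)
    show "1 \<in> H'" using H D(1) by blast
  next
    fix x assume "x \<in> H'"
    then obtain h i where hi: "h \<in> H" "[x = h * a ^ i] (mod int m)" using H'E by blast
    show "coprime x (int m)"
      using D(2)[OF hi(1)] a by (simp add: coprime_cong_cong_left[OF hi(2)])
    show "\<xi>' x \<noteq> 0" using val[OF hi] D(7)[OF hi(1)] w0 by simp
    fix b 
    {
      assume "[x = b] (mod int m)"
      hence b: "[b = h * a ^ i] (mod int m)" using hi(2) by (meson cong_sym cong_trans)
      show "b \<in> H'" by (rule mem[OF hi(1) b])
      show "\<xi>' b = \<xi>' x" using val[OF hi] val[OF hi(1) b] by simp
    next
      assume "b \<in> H'"
      then obtain h' j where hj: "h' \<in> H" "[b = h' * a ^ j] (mod int m)" using H'E by blast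
      have hh: "h * h' \<in> H" by (rule D(5)[OF hi(1) hj(1)])
      have c: "[x * b = (h * h') * a ^ (i + j)] (mod int m)"
        using cong_mult[OF hi(2) hj(2)] by (simp add: power_add mult_ac)
      show "x * b \<in> H'" by (rule mem[OF hh c])
      show "\<xi>' (x * b) = \<xi>' x * \<xi>' b"
        using val[OF hi] val[OF hj] val[OF hh c] D(6)[OF hi(1) hj(1)] by (simp add: power_add)
    }
  qed
  thus ?thesis using H aa by (intro exI[of _ H'] exI[of _ \<xi>']) auto
qed

lemma least_power_in:
  assumes "partial_char m H \<xi>" "m > 0" "coprime a (int m)"
  obtains n where "n > 0" "a ^ n \<in> H" "\<And>k. 0 < k \<Longrightarrow> k < n \<Longrightarrow> a ^ k \<notin> H"
proof -
  define P where "P = (\<lambda>n. n > 0 \<and> a ^ n \<in> H)"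
  have "P (totient m)"
    using assms(2) partial_charD(3)[OF assms(1) partial_charD(1)[OF assms(1)]
       cong_sym[OF euler_theorem_int[OF assms(2,3)]]] by (simp add: P_def)
  hence "P (LEAST n. P n)" by (rule LeastI)
  moreover have "\<not> P k" if "k < (LEAST n. P n)" for k using not_less_Least[OF that] .
  ultimately show ?thesis using that[of "LEAST n. P n"] by (auto simp: P_def)
qed

text \<open>Adjoin missing units one at a time, taking any complex root for the new value. Since
  \<open>H\<close> is an infinite set of integers, progress is measured by the residues in
  \<open>{0..<int m}\<close> still outside it.\<close>

lemma partial_char_total:
  assumes "partial_char m H \<xi>" "m > 0"
  shows "\<exists>\<psi>. dirichlet_character m \<psi> \<and> (\<forall>x\<in>H. \<psi> x = \<xi> x)"
  using assms(1)
proof (induction "card ({0..<int m} - H)" arbitrary: H \<xi> rule: less_induct)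
  case less
  note D = partial_charD[OF less.prems]
  show ?case
  proof (cases "\<forall>a. coprime a (int m) \<longrightarrow> a \<in> H")
    case True
    define \<psi> where "\<psi> = (\<lambda>a. if coprime a (int m) then \<xi> a else 0)"
    have iff: "coprime a (int m) \<longleftrightarrow> a \<in> H" for a using True D(2) by blast
    have "dirichlet_character m \<psi>"
      unfolding dirichlet_character_def
    proof (intro conjI allI)
      fix a b
      show "\<psi> (a * b) = \<psi> a * \<psi> b"
        using D(6)[of a b] by (auto simp: \<psi>_def iff[symmetric])
      have "[a = a + int m] (mod int m)" by (simp add: cong_iff_lin)
      from coprime_cong_cong_left[OF this] D(4)[OF _ this]
      show "\<psi> (a + int m) = \<psi> a" by (auto simp: \<psi>_def iff)
      show "(\<psi> a \<noteq> 0) = coprime a (int m)"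
        using D(7)[of a] by (auto simp: \<psi>_def iff)
    qed
    thus ?thesis by (intro exI[of _ \<psi>]) (auto simp: \<psi>_def D(2))
  next
    case False
    then obtain a where a: "coprime a (int m)" "a \<notin> H" by blast
    obtain n where n: "n > 0" "a ^ n \<in> H" "\<And>k. 0 < k \<Longrightarrow> k < n \<Longrightarrow> a ^ k \<notin> H"
      using least_power_in[OF less.prems assms(2) a(1)] by blast
    obtain w where w: "w ^ n = \<xi> (a ^ n)"
      using exists_complex_root[of n "\<xi> (a ^ n)"] n(1) by (metis less_numeral_extra(3))
    from partial_char_extend[OF less.prems assms(2) a(1) n w] obtain H' \<xi>' where
      H': "partial_char m H' \<xi>'" "insert a H \<subseteq> H'" "\<forall>x\<in>H. \<xi>' x = \<xi> x" by blast
    have r: "[a = a mod int m] (mod int m)" by simp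
    have "a mod int m \<in> H'" using partial_charD(3)[OF H'(1) _ r] H'(2) by auto
    moreover have "a mod int m \<notin> H" using D(3)[OF _ cong_sym[OF r]] a(2) by auto
    moreover have "a mod int m \<in> {0..<int m}" using assms(2) by simp
    ultimately have "{0..<int m} - H' \<subset> {0..<int m} - H" using H'(2) by blast
    hence "card ({0..<int m} - H') < card ({0..<int m} - H)" by (intro psubset_card_mono) auto
    from less.hyps[OF this H'(1)] H'(2,3) show ?thesis by (metis insert_subset subsetD)
  qed
qed

section \<open>Separation of units and orthogonality of characters\<close>

text \<open>Start from the trivial character on the class of 1. Relative to it \<open>a\<close> has
  order n > 1, so a nontrivial n-th root of unity may be prescribed as the value at
  \<open>a\<close>.\<close>

lemma dirichlet_character_separates:
  assumes m: "m > 0" and a: "coprime a (int m)" and neq: "\<not> [a = 1] (mod int m)"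
  shows "\<exists>\<psi>. dirichlet_character m \<psi> \<and> \<psi> a \<noteq> 1"
proof -
  define H where "H = {x. [x = 1] (mod int m)}"
  have pc: "partial_char m H (\<lambda>_. 1)"
    unfolding partial_char_def H_def
    by (auto intro: cong_trans cong_sym dest: cong_mult coprime_cong_cong_left)
  obtain n where n: "n > 0" "a ^ n \<in> H" "\<And>k. 0 < k \<Longrightarrow> k < n \<Longrightarrow> a ^ k \<notin> H"
    using least_power_in[OF pc m a] by blast
  have "a ^ 1 \<notin> H" using neq by (simp add: H_def)
  hence n1: "n > 1" using n(1,2) by (cases "n = 1") auto
  have "\<exists>w::complex. w ^ n = 1 \<and> w \<noteq> 1"
  proof (rule ccontr)
    assume "\<not> ?thesis"
    hence "{w::complex. w ^ n = 1} = {1}" by auto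
    thus False using card_roots_unity_eq[OF n(1)] n1 by simp
  qed
  then obtain w :: complex where w: "w ^ n = 1" "w \<noteq> 1" by blast
  from partial_char_extend[OF pc m a n, of w] w obtain H' \<xi>' where
    H': "partial_char m H' \<xi>'" "a \<in> H'" "\<xi>' a = w" by auto
  from partial_char_total[OF H'(1) m] H'(2,3) w(2) show ?thesis by metis
qed

text \<open>By periodicity the values on one residue system determine a character, and each value is
  0 or a root of unity of order dividing \<open>totient m\<close>.\<close>

lemma finite_dirichlet_characters:
  assumes "m > 0"
  shows "finite {\<psi>. dirichlet_character m \<psi>}"
proof (rule finite_imageD)
  define F where "F = (\<lambda>\<psi>::int \<Rightarrow> complex. restrict \<psi> {0..<int m})"
  define V :: "complex set" where "V = insert 0 {z. z ^ totient m = 1}"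
  have "finite V" unfolding V_def
    using finite_roots_unity[of "totient m", where ?'a = complex] assms by (simp add: Suc_leI)
  hence "finite (\<Pi>\<^sub>E x\<in>{0..<int m}. V)" by (intro finite_PiE) auto
  moreover have "F ` {\<psi>. dirichlet_character m \<psi>} \<subseteq> (\<Pi>\<^sub>E x\<in>{0..<int m}. V)"
  proof (clarify)
    fix \<psi> assume d: "dirichlet_character m \<psi>"
    have "\<psi> x \<in> V" for x
    proof (cases "coprime x (int m)")
      case True
      have "\<psi> x ^ totient m = 1"
        using dirichlet_character_cong[OF d euler_theorem_int[OF assms True]]
        by (simp add: dirichlet_character_power[OF d] dirichlet_character_1[OF d])
      thus ?thesis by (simp add: V_def)
    qed (simp add: V_def dirichlet_character_eq_0_iff[OF d])
    thus "F \<psi> \<in> (\<Pi>\<^sub>E x\<in>{0..<int m}. V)" by (simp add: F_def)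
  qed
  ultimately show "finite (F ` {\<psi>. dirichlet_character m \<psi>})" by (rule finite_subset[rotated])
  show "inj_on F {\<psi>. dirichlet_character m \<psi>}"
  proof (rule inj_onI, clarify)
    fix \<psi> \<psi>' assume d: "dirichlet_character m \<psi>" "dirichlet_character m \<psi>'" "F \<psi> = F \<psi>'"
    show "\<psi> = \<psi>'"
    proof
      fix x
      have r: "[x = x mod int m] (mod int m)" by simp
      have "x mod int m \<in> {0..<int m}" using assms by simp
      hence "\<psi> (x mod int m) = \<psi>' (x mod int m)"
        using d(3) unfolding F_def by (metis restrict_apply')
      thus "\<psi> x = \<psi>' x"
        using dirichlet_character_cong[OF d(1) r] dirichlet_character_cong[OF d(2) r] by simp
    qed
  qed
qed

lemma dirichlet_character_times:
  assumes "dirichlet_character m \<psi>" "dirichlet_character m \<xi>"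
  shows "dirichlet_character m (\<lambda>a. \<psi> a * \<xi> a)"
  using assms unfolding dirichlet_character_def by auto

lemma dirichlet_character_cnj:
  assumes "dirichlet_character m \<psi>"
  shows "dirichlet_character m (\<lambda>a. cnj (\<psi> a))"
  using assms unfolding dirichlet_character_def by auto

text \<open>Multiplication by a character \<open>\<xi>\<close> with
  \<open>\<xi> a \<noteq> 1\<close> permutes the characters, with inverse multiplication by its
  conjugate. The sum is thus fixed by a factor different from 1.\<close>

lemma sum_characters_eq_0:
  assumes m: "m > 0" and a: "coprime a (int m)" "\<not> [a = 1] (mod int m)"
  shows "(\<Sum>\<psi> | dirichlet_character m \<psi>. \<psi> a) = 0"
proof -
  define X where "X = {\<psi>. dirichlet_character m \<psi>}"
  from dirichlet_character_separates[OF m a] obtain \<xi> where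
    c: "dirichlet_character m \<xi>" "\<xi> a \<noteq> 1" by blast
  define \<xi>0 :: "int \<Rightarrow> complex" where "\<xi>0 = (\<lambda>a. if coprime a (int m) then 1 else 0)"
  have inv: "cnj (\<xi> x) * (\<xi> x * \<psi> x) = \<psi> x" if "dirichlet_character m \<psi>" for x \<psi>
  proof (cases "coprime x (int m)")
    case True
    hence "cnj (\<xi> x) * \<xi> x = 1"
      using norm_dirichlet_character[OF c(1) m True] complex_norm_square[of "\<xi> x"] by (simp add: mult.commute)
    thus ?thesis by (simp flip: mult.assoc)
  qed (simp add: dirichlet_character_eq_0_iff[OF that])
  have inv': "\<xi> x * (cnj (\<xi> x) * \<psi> x) = \<psi> x" if "dirichlet_character m \<psi>" for x \<psi>
    using inv[OF that, of x] by (simp add: mult_ac)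
  have "(\<Sum>\<psi>\<in>X. \<psi> a) = (\<Sum>\<psi>\<in>X. \<xi> a * \<psi> a)"
    by (rule sum.reindex_bij_witness[of _ "\<lambda>\<psi> x. \<xi> x * \<psi> x" "\<lambda>\<psi> x. cnj (\<xi> x) * \<psi> x"])
       (auto simp: X_def inv inv' dirichlet_character_times dirichlet_character_cnj c(1))
  also have "\<dots> = \<xi> a * (\<Sum>\<psi>\<in>X. \<psi> a)" by (simp add: sum_distrib_left)
  finally show ?thesis using c(2) by (simp add: X_def)
qed

section \<open>Sums over residues coprime to the modulus\<close>

lemma coprime_iff_prime_factors:
  fixes a f :: nat
  assumes "f > 0"
  shows "coprime a f \<longleftrightarrow> (\<forall>q\<in>prime_factors f. \<not> q dvd a)"
proof
  assume "coprime a f"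
  thus "\<forall>q\<in>prime_factors f. \<not> q dvd a"
    by (metis coprime_common_divisor in_prime_factors_iff not_prime_unit)
next
  assume *: "\<forall>q\<in>prime_factors f. \<not> q dvd a"
  show "coprime a f"
  proof (rule ccontr)
    assume "\<not> coprime a f"
    hence "gcd a f \<noteq> 1" using coprime_iff_gcd_eq_1 by blast
    then obtain p where "prime p" "p dvd gcd a f" using prime_factor_nat by blast
    thus False using * assms by (auto simp: in_prime_factors_iff)
  qed
qed

text \<open>Inclusion-exclusion, one prime of \<open>P\<close> at a time: the multiples of \<open>p\<close> below \<open>m\<close> give the same
  sum with \<open>m\<close> replaced by \<open>m / p\<close>, which multiplies each \<open>h s m\<close> by \<open>1 / h s p\<close>.\<close>

lemma sum_sieve:
  fixes g :: "real \<Rightarrow> real" and c :: "'s \<Rightarrow> real" and h :: "'s \<Rightarrow> nat \<Rightarrow> real"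
  assumes f: "f > 0"
    and H: "\<And>m. m dvd f \<Longrightarrow> (\<Sum>a<m. g (real a / real m)) = (\<Sum>s\<in>S. c s * h s m)"
    and mult: "\<And>s p m. s \<in> S \<Longrightarrow> prime p \<Longrightarrow> p * m dvd f \<Longrightarrow> h s (p * m) = h s p * h s m"
    and nz: "\<And>s p. s \<in> S \<Longrightarrow> p \<in> prime_factors f \<Longrightarrow> h s p \<noteq> 0"
  shows "finite P \<Longrightarrow> P \<subseteq> prime_factors m \<Longrightarrow> m dvd f \<Longrightarrow>
    (\<Sum>a | a < m \<and> (\<forall>q\<in>P. \<not> q dvd a). g (real a / real m)) =
    (\<Sum>s\<in>S. c s * (h s m * (\<Prod>q\<in>P. 1 - 1 / h s q)))"
proof (induction P arbitrary: m rule: finite_induct)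
  case empty
  have "{a. a < m \<and> (\<forall>q\<in>{}. \<not> q dvd a)} = {..<m}" by auto
  thus ?case using H[OF empty.prems(2)] by simp
next
  case (insert p P)
  have p: "prime p" "p dvd m" using insert.prems(1) by auto
  then obtain m' where m': "m = p * m'" by blast
  have m0: "m > 0" using insert.prems(2) f by (auto intro: Nat.gr0I)
  have p0: "p > 0" "m' > 0" using m0 m' by auto
  \<comment> \<open>Only the primes remaining in \<open>P\<close> must divide m / p; p itself may no
    longer do so.\<close>
  have P': "P \<subseteq> prime_factors m'"
  proof
    fix q assume q: "q \<in> P"
    hence "prime q" "q dvd p * m'" "q \<noteq> p" using insert.prems(1) insert.hyps(2) m' by auto
    hence "q dvd m'" using p(1) by (metis prime_dvd_mult_iff primes_dvd_imp_eq)
    thus "q \<in> prime_factors m'" using \<open>prime q\<close> p0 by (simp add: in_prime_factors_iff)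
  qed
  have m'f: "m' dvd f" using insert.prems(2) m' by (metis dvd_mult_right)
  have pf: "p \<in> prime_factors f"
    using p insert.prems(2) f by (auto simp: in_prime_factors_iff intro: dvd_trans)
  define A where "A = {a. a < m \<and> (\<forall>q\<in>P. \<not> q dvd a)}"
  have A: "finite A" by (simp add: A_def)
  have "(\<Sum>a\<in>A. g (real a / real m)) = (\<Sum>a\<in>{a\<in>A. \<not> p dvd a}. g (real a / real m))
      + (\<Sum>a\<in>{a\<in>A. p dvd a}. g (real a / real m))"
    using A by (subst sum.union_disjoint [symmetric]) (auto intro: sum.cong)
  \<comment> \<open>Writing a = p a' gives a / m = a' / m', and a prime q in \<open>P\<close>
    differs from p, so it divides a exactly when it divides a'.\<close>
  also have "(\<Sum>a\<in>{a\<in>A. p dvd a}. g (real a / real m)) =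
      (\<Sum>a | a < m' \<and> (\<forall>q\<in>P. \<not> q dvd a). g (real a / real m'))"
  proof (rule sum.reindex_bij_witness[of _ "\<lambda>a. p * a" "\<lambda>a. a div p"])
    fix a assume a: "a \<in> {a. a < m' \<and> (\<forall>q\<in>P. \<not> q dvd a)}"
    have "\<not> q dvd p * a" if "q \<in> P" for q
    proof
      assume "q dvd p * a"
      moreover have "prime q" "q \<noteq> p" using that insert.prems(1) insert.hyps(2) by auto
      ultimately have "q dvd a" using p(1) by (metis prime_dvd_mult_iff primes_dvd_imp_eq)
      thus False using a that by auto
    qed
    thus "p * a \<in> {a \<in> A. p dvd a}" using a p0 by (auto simp: A_def m')
  qed (use p0 in \<open>auto simp: A_def m' elim!: dvdE\<close>)
  also have "\<dots> = (\<Sum>s\<in>S. c s * (h s m' * (\<Prod>q\<in>P. 1 - 1 / h s q)))"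
    by (rule insert.IH[OF P' m'f])
  also have "(\<Sum>a\<in>A. g (real a / real m)) = (\<Sum>s\<in>S. c s * (h s m * (\<Prod>q\<in>P. 1 - 1 / h s q)))"
    unfolding A_def using insert.prems by (intro insert.IH) auto
  also have "{a\<in>A. \<not> p dvd a} = {a. a < m \<and> (\<forall>q\<in>insert p P. \<not> q dvd a)}"
    by (auto simp: A_def)
  finally have "(\<Sum>a | a < m \<and> (\<forall>q\<in>insert p P. \<not> q dvd a). g (real a / real m)) =
     (\<Sum>s\<in>S. c s * (h s m * (\<Prod>q\<in>P. 1 - 1 / h s q))) - (\<Sum>s\<in>S. c s * (h s m' * (\<Prod>q\<in>P. 1 - 1 / h s q)))"
    by simp
  also have "\<dots> = (\<Sum>s\<in>S. c s * (h s m * (\<Prod>q\<in>insert p P. 1 - 1 / h s q)))"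
    unfolding sum_subtractf [symmetric]
  proof (rule sum.cong[OF refl])
    fix s assume s: "s \<in> S"
    have "h s m = h s p * h s m'" using mult[OF s p(1)] insert.prems(2) m' by simp
    thus "c s * (h s m * (\<Prod>q\<in>P. 1 - 1 / h s q)) - c s * (h s m' * (\<Prod>q\<in>P. 1 - 1 / h s q)) =
       c s * (h s m * (\<Prod>q\<in>insert p P. 1 - 1 / h s q))"
      using insert.hyps nz[OF s pf] by (simp add: field_simps)
  qed
  finally show ?case .
qed

text \<open>Totatives lie between 1 and f, the sieve runs from 0 to f - 1; the two ranges differ in
  0 and f only, neither coprime to f > 1.\<close>

lemma sum_totatives:
  fixes g :: "real \<Rightarrow> real" and c :: "'s \<Rightarrow> real" and h :: "'s \<Rightarrow> nat \<Rightarrow> real"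
  assumes f: "f > 1"
    and H: "\<And>m. m dvd f \<Longrightarrow> (\<Sum>a<m. g (real a / real m)) = (\<Sum>s\<in>S. c s * h s m)"
    and mult: "\<And>s p m. s \<in> S \<Longrightarrow> prime p \<Longrightarrow> p * m dvd f \<Longrightarrow> h s (p * m) = h s p * h s m"
    and nz: "\<And>s p. s \<in> S \<Longrightarrow> p \<in> prime_factors f \<Longrightarrow> h s p \<noteq> 0"
  shows "(\<Sum>a\<in>totatives f. g (real a / real f)) =
    (\<Sum>s\<in>S. c s * (h s f * (\<Prod>q\<in>prime_factors f. 1 - 1 / h s q)))"
proof -
  have "totatives f = {a. a < f \<and> coprime a f}"
  proof (intro Set.set_eqI iffI)
    fix x assume "x \<in> totatives f"
    thus "x \<in> {a. a < f \<and> coprime a f}" using totatives_less[of x f] f by (simp add: in_totatives_iff)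
  next
    fix x assume x: "x \<in> {a. a < f \<and> coprime a f}"
    hence "x \<noteq> 0" using f by (metis coprime_0_left_iff mem_Collect_eq nat_dvd_1_iff_1 less_irrefl)
    thus "x \<in> totatives f" using x by (simp add: in_totatives_iff)
  qed
  hence "totatives f = {a. a < f \<and> (\<forall>q\<in>prime_factors f. \<not> q dvd a)}"
    using f by (simp add: coprime_iff_prime_factors)
  thus ?thesis using sum_sieve[of f g c h S "prime_factors f" f] assms by simp
qed

text \<open>Sieve the closed form (m^2 - 1) / 3, a combination of the multiplicative functions m^2
  and 1.\<close>

lemma sum_inverse_sin_sq_totatives:
  assumes "d > 1"
  shows "(\<Sum>k\<in>totatives d. 1 / (sin (pi * (real k / real d)))\<^sup>2) =
    (real d)\<^sup>2 / 3 * (\<Prod>q\<in>prime_factors d. 1 - 1 / (real q)\<^sup>2)"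
proof -
  define h :: "bool \<Rightarrow> nat \<Rightarrow> real" where "h = (\<lambda>s m. if s then (real m)\<^sup>2 else 1)"
  have "(\<Sum>k\<in>totatives d. 1 / (sin (pi * (real k / real d)))\<^sup>2) =
    (\<Sum>s\<in>UNIV. (if s then 1 / 3 else - 1 / 3) * (h s d * (\<Prod>q\<in>prime_factors d. 1 - 1 / h s q)))"
  proof (rule sum_totatives[OF assms, where g = "\<lambda>y. 1 / (sin (pi * y))\<^sup>2"])
    fix m assume "m dvd d"
    hence "m > 0" using assms by (auto intro: Nat.gr0I)
    from sum_inverse_sin_sq[OF this]
    show "(\<Sum>a<m. 1 / (sin (pi * (real a / real m)))\<^sup>2) =
      (\<Sum>s\<in>UNIV. (if s then 1 / 3 else - 1 / 3) * h s m)"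
      by (simp add: UNIV_bool h_def diff_divide_distrib)
  qed (auto simp: h_def power_mult_distrib in_prime_factors_iff)
  \<comment> \<open>The constant function has Euler factors 1 - 1 = 0, and d > 1 has at least one
    prime factor, so its contribution disappears.\<close>
  moreover have "(\<Prod>q\<in>prime_factors d. 1 - 1 / h False q) = 0"
  proof -
    obtain p where "prime p" "p dvd d" using prime_factor_nat[of d] assms by auto
    hence "p \<in> prime_factors d" using assms by (simp add: in_prime_factors_iff)
    thus ?thesis by (intro prod_zero) (auto simp: h_def)
  qed
  ultimately show ?thesis by (simp add: UNIV_bool h_def)
qed

section \<open>The cotangent sum over units and its second moment\<close>

text \<open>The function called g in the overview.\<close>

definition cot_sum :: "nat \<Rightarrow> real \<Rightarrow> real" where
  "cot_sum d y = (\<Sum>k\<in>totatives d. cotpi (y + real k / real d))"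

lemma totatives_reflect:
  assumes "d > 1" "k \<in> totatives d"
  shows "d - k \<in> totatives d"
proof -
  have "k < d" by (rule totatives_less) (use assms in auto)
  moreover have "coprime (d - k) d"
    using assms \<open>k < d\<close> by (metis in_totatives_iff coprime_iff_gcd_eq_1 less_imp_le gcd.commute gcd_diff2_nat)
  ultimately show ?thesis by (simp add: in_totatives_iff)
qed

text \<open>Reflect k to d - k and use that \<open>cotpi\<close> is odd with period 1. At y = 0 this
  yields the vanishing of the sum of cot(pi k / d) over the units.\<close>

lemma cot_sum_minus:
  assumes "d > 1"
  shows "cot_sum d (- y) = - cot_sum d y"
proof -
  have le: "k \<le> d" if "k \<in> totatives d" for k using that by (rule totatives_le)
  have "cot_sum d (- y) = (\<Sum>k\<in>totatives d. cotpi (- y + real (d - k) / real d))"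
    unfolding cot_sum_def
    by (rule sum.reindex_bij_witness[of _ "\<lambda>k. d - k" "\<lambda>k. d - k"])
       (use totatives_reflect[OF assms] le in auto)
  also have "\<dots> = (\<Sum>k\<in>totatives d. - cotpi (y + real k / real d))"
  proof (rule sum.cong[OF refl])
    fix k assume "k \<in> totatives d"
    hence "- y + real (d - k) / real d = - (y + real k / real d) + of_int 1"
      using le assms by (simp add: of_nat_diff diff_divide_distrib)
    thus "cotpi (- y + real (d - k) / real d) = - cotpi (y + real k / real d)"
      by (simp only: cotpi_add_int cotpi_minus)
  qed
  finally show ?thesis by (simp add: cot_sum_def sum_negf)
qed

lemma totatives_divide_notin_Ints:
  assumes "d > 1" "k \<in> totatives d"
  shows "real k / real d \<notin> \<int>"
  using assms totatives_less[of k d] by (intro divide_notin_Ints) (auto simp: in_totatives_iff)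

text \<open>Expand the square into pairs (k, l) of units. Off the diagonal, linearizing, summing
  over a and applying \<open>cotpi_mult\<close> backwards gives +-F (1 + cot(pi k / d) cot(pi l /
  d)) - F; the diagonal has an additional multiple of 1 / sin(pi k / d)^2.\<close>

lemma sum_cot_sum_sq:
  assumes F: "F > 0" and d: "d > 1" and e: "e = 1 \<or> e = -1" "[int F = e] (mod int d)"
  shows "(\<Sum>a<F. (cot_sum d (real a / real F))\<^sup>2) =
     (real F)\<^sup>2 * (\<Sum>k\<in>totatives d. 1 / (sin (pi * (real k / real d)))\<^sup>2)
     - real F * (real (totient d))\<^sup>2
     + real F * of_int e * ((real (totient d))\<^sup>2 - (\<Sum>k\<in>totatives d. 1 / (sin (pi * (real k / real d)))\<^sup>2))"
    (is "_ = _ * ?J - _ + _")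
proof -
  define x where "x = (\<lambda>k. real k / real d)"
  obtain t where "e = int F + int d * t" using e(2) by (auto simp: cong_iff_lin)
  hence t: "int F = e + (- t) * int d" by (simp add: algebra_simps)
  \<comment> \<open>From F = e - t d, the number F k / d differs from e k / d by the integer -t k.
    The congruence on F enters only through this identity.\<close>
  have Fx: "real F * x k = of_int e * x k + of_int (- t * int k)" for k
  proof -
    have "real F = of_int e + of_int (- t) * real d"
      using arg_cong[OF t, of real_of_int] by simp
    hence "real F * x k = (of_int e + of_int (- t) * real d) * x k" by (simp only:)
    also have "\<dots> = of_int e * x k + of_int (- t) * (real d * x k)"
      by (simp only: distrib_right mult.assoc)
    also have "real d * x k = of_int (int k)" using d by (simp add: x_def)
    finally show ?thesis by (simp only: of_int_mult)
  qed
  have xI: "x k \<notin> \<int>" if "k \<in> totatives d" for k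
    using totatives_divide_notin_Ints[OF d that] by (simp add: x_def)
  have FxI: "real F * x k \<notin> \<int>" if "k \<in> totatives d" for k
  proof
    assume "real F * x k \<in> \<int>"
    hence "real F * x k - of_int (- t * int k) \<in> \<int>" by (intro Ints_diff) auto
    hence "of_int e * x k \<in> \<int>" unfolding Fx by simp
    thus False using e(1) xI[OF that] by auto
  qed
  have cF: "cotpi (real F * x k) = of_int e * cotpi (x k)" for k
    unfolding Fx cotpi_add_int using e(1) by auto
  have nI: "real a / real F + x k \<notin> \<int>" if "k \<in> totatives d" for a k
    using add_divide_notin_Ints[OF F FxI[OF that]] by (simp add: add.commute)
  have s1: "(\<Sum>a<F. cotpi (real a / real F + x k)) = real F * (of_int e * cotpi (x k))"
    if "k \<in> totatives d" for k
    using sum_cotpi_shift[OF F FxI[OF that]] by (simp add: cF add.commute)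
  have e2: "(of_int e :: real) * of_int e = 1" using e(1) by auto
  define T where "T = (\<lambda>k l. \<Sum>a<F. cotpi (real a / real F + x k) * cotpi (real a / real F + x l))"
  \<comment> \<open>One expression for all pairs: the surplus on the diagonal uses cot^2 = 1 / sin^2
    - 1 and is what brings in the sum of inverse squared sines.\<close>
  have T: "T k l = real F * of_int e * (1 + cotpi (x k) * cotpi (x l)) - real F
      + (if k = l then ((real F)\<^sup>2 - real F * of_int e) * (1 / (sin (pi * x k))\<^sup>2) else 0)"
    if kl: "k \<in> totatives d" "l \<in> totatives d" for k l
  proof (cases "k = l")
    case True
    have "T k l = (real F)\<^sup>2 * (1 + (cotpi (real F * x k))\<^sup>2) - real F"
      using sum_cotpi_sq_shift[OF F FxI[OF kl(1)]] True
      by (simp add: T_def power2_eq_square add.commute)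
    also have "(cotpi (real F * x k))\<^sup>2 = (cotpi (x k))\<^sup>2"
      using e2 by (simp add: cF power_mult_distrib power2_eq_square)
    finally show ?thesis using True inverse_sin_sq[OF xI[OF kl(1)]]
      by (simp add: algebra_simps power2_eq_square)
  next
    case False
    have lt: "k < d" "l < d" using totatives_less[OF kl(1)] totatives_less[OF kl(2)] d by auto
    have dI: "x k - x l \<notin> \<int>"
      unfolding x_def by (rule divide_diff_notin_Ints[OF lt False])
    have "T k l = (\<Sum>a<F. cotpi (x k - x l) * (cotpi (real a / real F + x l) - cotpi (real a / real F + x k)) - 1)"
      unfolding T_def
    proof (rule sum.cong[OF refl])
      fix a
      have "(real a / real F + x k) - (real a / real F + x l) = x k - x l" by simp
      thus "cotpi (real a / real F + x k) * cotpi (real a / real F + x l) =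
         cotpi (x k - x l) * (cotpi (real a / real F + x l) - cotpi (real a / real F + x k)) - 1"
        using cotpi_mult[OF nI[OF kl(1)] nI[OF kl(2)], of a a] dI by simp
    qed
    also have "\<dots> = cotpi (x k - x l) * ((\<Sum>a<F. cotpi (real a / real F + x l)) - (\<Sum>a<F. cotpi (real a / real F + x k))) - real F"
      by (simp add: sum_subtractf sum_distrib_left [symmetric])
    also have "\<dots> = real F * of_int e * (cotpi (x k - x l) * (cotpi (x l) - cotpi (x k))) - real F"
      by (simp only: s1 kl) (simp add: algebra_simps)
    \<comment> \<open>\<open>cotpi_mult\<close> read backwards, now at the points k / d and l / d
      without the shift a / F.\<close>
    also have "cotpi (x k - x l) * (cotpi (x l) - cotpi (x k)) = 1 + cotpi (x k) * cotpi (x l)"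
      using cotpi_mult[OF xI[OF kl(1)] xI[OF kl(2)] dI] by simp
    finally show ?thesis using False by simp
  qed
  have c0: "(\<Sum>k\<in>totatives d. cotpi (x k)) = 0"
    using cot_sum_minus[OF d, of 0] by (simp add: cot_sum_def x_def)
  define v where "v = (\<lambda>k. 1 / (sin (pi * x k))\<^sup>2)"
  have "(\<Sum>a<F. (cot_sum d (real a / real F))\<^sup>2) = (\<Sum>k\<in>totatives d. \<Sum>l\<in>totatives d. T k l)"
  proof -
    have "(\<Sum>a<F. (cot_sum d (real a / real F))\<^sup>2) =
       (\<Sum>a<F. \<Sum>k\<in>totatives d. \<Sum>l\<in>totatives d. cotpi (real a / real F + x k) * cotpi (real a / real F + x l))"
      by (simp add: cot_sum_def power2_eq_square sum_product x_def)
    also have "\<dots> = (\<Sum>k\<in>totatives d. \<Sum>a<F. \<Sum>l\<in>totatives d. cotpi (real a / real F + x k) * cotpi (real a / real F + x l))"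
      by (rule sum.swap)
    also have "\<dots> = (\<Sum>k\<in>totatives d. \<Sum>l\<in>totatives d. T k l)"
      unfolding T_def by (rule sum.cong[OF refl sum.swap])
    finally show ?thesis .
  qed
  also have "\<dots> = (\<Sum>k\<in>totatives d. \<Sum>l\<in>totatives d. 
       real F * of_int e * (1 + cotpi (x k) * cotpi (x l)) - real F
      + (if k = l then ((real F)\<^sup>2 - real F * of_int e) * v k else 0))"
    unfolding v_def by (intro sum.cong refl T)
  also have "\<dots> = real F * of_int e * ((real (totient d))\<^sup>2 + 
       (\<Sum>k\<in>totatives d. cotpi (x k)) * (\<Sum>l\<in>totatives d. cotpi (x l))) - real F * (real (totient d))\<^sup>2
      + ((real F)\<^sup>2 - real F * of_int e) * (\<Sum>k\<in>totatives d. v k)"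
    by (simp add: sum.distrib sum_subtractf sum_distrib_left [symmetric] sum_product totient_def power2_eq_square[of "real (card (totatives d))"])
  finally show ?thesis unfolding c0 by (simp add: x_def v_def algebra_simps)
qed

section \<open>The mean square over odd characters\<close>

lemma dirichlet_character_minus_1:
  assumes "dirichlet_character m \<psi>"
  shows "\<psi> (- 1) = 1 \<or> \<psi> (- 1) = - 1"
proof -
  have "\<psi> (- 1) * \<psi> (- 1) = 1"
    using dirichlet_character_mult[OF assms, of "-1" "-1"] dirichlet_character_1[OF assms] by simp
  thus ?thesis by (simp add: square_eq_1_iff)
qed

text \<open>For m > 2 the classes of 1 and -1 differ, so the values at -1 of all characters add up
  to 0; that sum counts even minus odd characters. Positivity comes from the principal
  character.\<close>

lemma card_characters_eq:
  assumes "m > 2"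
  shows "card {\<psi>. dirichlet_character m \<psi>} = 2 * card (odd_characters m)" "card (odd_characters m) > 0"
proof -
  define X where "X = {\<psi>. dirichlet_character m \<psi>}"
  have fin: "finite X" unfolding X_def using assms by (intro finite_dirichlet_characters) simp
  have odd: "odd_characters m = {\<psi>\<in>X. \<psi> (- 1) = - 1}" by (auto simp: X_def odd_characters_def)
  have "\<not> [- 1 = 1] (mod int m)" 
  proof
    assume "[- 1 = 1] (mod int m)"
    hence "int m dvd (- 1) - 1" by (simp only: cong_iff_dvd_diff)
    hence "int m dvd 2" by simp
    hence "int m \<le> 2" by (rule zdvd_imp_le) simp
    thus False using assms by simp
  qed
  hence "0 = (\<Sum>\<psi>\<in>X. \<psi> (- 1))"
    unfolding X_def using assms by (subst sum_characters_eq_0) auto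
  \<comment> \<open>A sign is 1 minus twice the indicator of being -1.\<close>
  also have "\<dots> = (\<Sum>\<psi>\<in>X. 1 - 2 * (if \<psi> (- 1) = - 1 then 1 else 0))"
    using dirichlet_character_minus_1 by (intro sum.cong) (auto simp: X_def)
  also have "\<dots> = of_nat (card X) - 2 * of_nat (card (odd_characters m))"
    using fin by (simp add: sum_subtractf sum_distrib_left [symmetric] odd sum.If_cases Int_def)
  finally have "complex_of_nat (card X) = of_nat (2 * card (odd_characters m))" by simp
  hence c: "card X = 2 * card (odd_characters m)" by (simp only: of_nat_eq_iff)
  thus "card {\<psi>. dirichlet_character m \<psi>} = 2 * card (odd_characters m)" by (simp add: X_def)
  have "coprime (a + int m) (int m) \<longleftrightarrow> coprime a (int m)" for a
    by (rule coprime_cong_cong_left) (simp add: cong_iff_dvd_diff)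
  hence "dirichlet_character m (\<lambda>a. if coprime a (int m) then 1 else 0)"
    by (auto simp: dirichlet_character_def)
  hence "X \<noteq> {}" by (auto simp: X_def)
  hence "card X > 0" using fin by (simp add: card_gt_0_iff)
  thus "card (odd_characters m) > 0" using c by simp
qed

text \<open>Off the diagonal, conjugation amounts to evaluation at the inverse of b, realized as
  b^(totient m - 1), so the sum is that of all characters at a nontrivial unit.\<close>

lemma sum_characters_orthogonal:
  assumes m: "m > 1" and ab: "a \<in> totatives m" "b \<in> totatives m"
  shows "(\<Sum>\<psi> | dirichlet_character m \<psi>. \<psi> (int a) * cnj (\<psi> (int b))) =
    (if a = b then of_nat (card {\<psi>. dirichlet_character m \<psi>}) else 0)"
proof -
  have cop: "coprime (int a) (int m)" "coprime (int b) (int m)"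
    using ab by (auto simp: in_totatives_iff)
  show ?thesis
  proof (cases "a = b")
    case True
    have "(\<Sum>\<psi> | dirichlet_character m \<psi>. \<psi> (int a) * cnj (\<psi> (int b))) = (\<Sum>\<psi> | dirichlet_character m \<psi>. 1)"
    proof (rule sum.cong[OF refl])
      fix \<psi> assume "\<psi> \<in> {\<psi>. dirichlet_character m \<psi>}"
      hence "norm (\<psi> (int b)) = 1" using norm_dirichlet_character[of m \<psi> "int b"] m cop by simp
      thus "\<psi> (int a) * cnj (\<psi> (int b)) = 1"
        using complex_norm_square[of "\<psi> (int b)"] True by simp
    qed
    thus ?thesis using True by simp
  next
    case False
    define b' where "b' = int b ^ (totient m - 1)"
    have "b' * int b = int b ^ totient m"
      unfolding b'_def using m by (intro power_minus_mult) simp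
    hence bb: "[b' * int b = 1] (mod int m)" using euler_theorem_int[OF _ cop(2)] m by simp
    have cnj: "cnj (\<psi> (int b)) = \<psi> b'" if d: "dirichlet_character m \<psi>" for \<psi>
    proof -
      have "\<psi> b' * \<psi> (int b) = 1"
        using dirichlet_character_cong[OF d bb] dirichlet_character_mult[OF d] dirichlet_character_1[OF d] by simp
      moreover have "\<psi> (int b) * cnj (\<psi> (int b)) = 1"
        using norm_dirichlet_character[OF d _ cop(2)] complex_norm_square[of "\<psi> (int b)"] m by simp
      ultimately show ?thesis by (metis mult.assoc mult.left_neutral mult.right_neutral)
    qed
    have "(\<Sum>\<psi> | dirichlet_character m \<psi>. \<psi> (int a) * cnj (\<psi> (int b))) = (\<Sum>\<psi> | dirichlet_character m \<psi>. \<psi> (int a * b'))"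
      by (intro sum.cong refl) (simp add: cnj dirichlet_character_mult)
    also have "\<dots> = 0"
    proof (rule sum_characters_eq_0)
      show "coprime (int a * b') (int m)" using cop by (simp add: b'_def)
      show "\<not> [int a * b' = 1] (mod int m)"
      proof
        assume "[int a * b' = 1] (mod int m)"
        hence "[int a * b' * int b = 1 * int b] (mod int m)" by (rule cong_mult) simp
        moreover have "[int a * (b' * int b) = int a * 1] (mod int m)" by (rule cong_mult[OF _ bb]) simp
        ultimately have "[int a = int b] (mod int m)" by (metis cong_sym cong_trans mult.assoc mult_1 mult.right_neutral)
        hence "[a = b] (mod m)" by (simp only: cong_int_iff)
        moreover have "a < m" "b < m" using totatives_less ab m by auto
        ultimately show False using False by (simp add: unique_euclidean_semiring_class.cong_def)
      qed
    qed (use m in simp)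
    finally show ?thesis using False by simp
  qed
qed

text \<open>Even characters contribute nothing for odd \<open>g\<close>, so orthogonality over all characters suffices.\<close>

lemma mean_square_odd_characters:
  fixes g :: "nat \<Rightarrow> real"
  assumes m: "m > 2" and g: "\<And>a. a \<in> totatives m \<Longrightarrow> g (m - a) = - g a"
  shows "(\<Sum>\<psi>\<in>odd_characters m. (cmod (\<Sum>a\<in>totatives m. \<psi> (int a) * of_real (g a)))\<^sup>2) =
     2 * real (card (odd_characters m)) * (\<Sum>a\<in>totatives m. (g a)\<^sup>2)"
proof -
  define X where "X = {\<psi>. dirichlet_character m \<psi>}"
  have fin: "finite X" unfolding X_def using m by (intro finite_dirichlet_characters) simp
  define S where "S = (\<lambda>\<psi>::int \<Rightarrow> complex. \<Sum>a\<in>totatives m. \<psi> (int a) * of_real (g a))"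
  have le: "a \<le> m" if "a \<in> totatives m" for a using that by (rule totatives_le)
  \<comment> \<open>For an even character the reflection a to m - a sends the sum to its
    negative.\<close>
  have S0: "S \<psi> = 0" if "\<psi> \<in> X - odd_characters m" for \<psi>
  proof -
    have d: "dirichlet_character m \<psi>" and e: "\<psi> (- 1) = 1"
      using that dirichlet_character_minus_1[of m \<psi>] by (auto simp: X_def odd_characters_def)
    have "S \<psi> = (\<Sum>a\<in>totatives m. \<psi> (int (m - a)) * of_real (g (m - a)))"
      unfolding S_def
      by (rule sum.reindex_bij_witness[of _ "\<lambda>a. m - a" "\<lambda>a. m - a"])
         (use totatives_reflect[of m] le m in auto)
    also have "\<dots> = (\<Sum>a\<in>totatives m. - (\<psi> (int a) * of_real (g a)))"
    proof (rule sum.cong[OF refl])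
      fix a assume a: "a \<in> totatives m"
      have "int (m - a) = - 1 * int a + int m" using le[OF a] by (simp add: of_nat_diff)
      hence "\<psi> (int (m - a)) = \<psi> (- 1 * int a)"
        using dirichlet_character_periodic[OF d] by (simp only:)
      also have "\<dots> = \<psi> (int a)" by (simp only: dirichlet_character_mult[OF d] e mult_1)
      finally show "\<psi> (int (m - a)) * of_real (g (m - a)) = - (\<psi> (int a) * of_real (g a))"
        using g[OF a] by simp
    qed
    also have "\<dots> = - S \<psi>" by (simp add: S_def sum_negf)
    finally show ?thesis by (simp add: equal_neg_zero)
  qed
  have "(\<Sum>\<psi>\<in>odd_characters m. (cmod (S \<psi>))\<^sup>2) = (\<Sum>\<psi>\<in>X. (cmod (S \<psi>))\<^sup>2)"
    using fin S0 by (intro sum.mono_neutral_left) (auto simp: X_def odd_characters_def)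
  moreover have "complex_of_real (\<Sum>\<psi>\<in>X. (cmod (S \<psi>))\<^sup>2) = of_real (real (card X) * (\<Sum>a\<in>totatives m. (g a)\<^sup>2))"
  proof -
    have "complex_of_real (\<Sum>\<psi>\<in>X. (cmod (S \<psi>))\<^sup>2) = 
       (\<Sum>\<psi>\<in>X. \<Sum>a\<in>totatives m. \<Sum>b\<in>totatives m. of_real (g a * g b) * (\<psi> (int a) * cnj (\<psi> (int b))))"
      unfolding of_real_sum
    proof (rule sum.cong[OF refl])
      fix \<psi> assume "\<psi> \<in> X"
      have "complex_of_real ((cmod (S \<psi>))\<^sup>2) = S \<psi> * cnj (S \<psi>)" by (rule complex_norm_square)
      also have "cnj (S \<psi>) = (\<Sum>b\<in>totatives m. cnj (\<psi> (int b)) * of_real (g b))" by (simp add: S_def)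
      finally show "complex_of_real ((cmod (S \<psi>))\<^sup>2) =
         (\<Sum>a\<in>totatives m. \<Sum>b\<in>totatives m. of_real (g a * g b) * (\<psi> (int a) * cnj (\<psi> (int b))))"
        by (simp add: S_def sum_product mult_ac)
    qed
    also have "\<dots> = (\<Sum>a\<in>totatives m. \<Sum>\<psi>\<in>X. \<Sum>b\<in>totatives m. of_real (g a * g b) * (\<psi> (int a) * cnj (\<psi> (int b))))"
      by (rule sum.swap)
    also have "\<dots> = (\<Sum>a\<in>totatives m. \<Sum>b\<in>totatives m. \<Sum>\<psi>\<in>X. of_real (g a * g b) * (\<psi> (int a) * cnj (\<psi> (int b))))"
      by (rule sum.cong[OF refl sum.swap])
    also have "\<dots> = (\<Sum>a\<in>totatives m. \<Sum>b\<in>totatives m. if a = b then of_real (g a * g b) * of_nat (card X) else 0)"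
      using m by (intro sum.cong refl)
         (simp add: sum_distrib_left [symmetric] X_def sum_characters_orthogonal del: of_real_mult)
    also have "\<dots> = of_real (real (card X) * (\<Sum>a\<in>totatives m. (g a)\<^sup>2))"
      by (simp add: sum_distrib_left power2_eq_square mult_ac)
    finally show ?thesis .
  qed
  hence "(\<Sum>\<psi>\<in>X. (cmod (S \<psi>))\<^sup>2) = real (card X) * (\<Sum>a\<in>totatives m. (g a)\<^sup>2)"
    by (simp only: of_real_eq_iff)
  ultimately show ?thesis using card_characters_eq(1)[OF m] by (simp add: S_def X_def)
qed

text \<open>The residue attached to \<open>(a, k)\<close> is chosen so that, divided by \<open>d f\<close>, it equals
  \<open>a / f + k / d\<close> modulo 1.\<close>

lemma bij_betw_totatives_crt:
  fixes d f :: nat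
  assumes "d > 1" "f > 1" "coprime d f"
  shows "bij_betw (\<lambda>(a, k). (a * d + k * f) mod (d * f)) (totatives f \<times> totatives d) (totatives (d * f))"
proof -
  let ?h = "\<lambda>(a, k). (a * d + k * f) mod (d * f)"
  have df: "d * f > 1" using assms by (simp add: one_less_mult)
  have inj: "inj_on ?h (totatives f \<times> totatives d)"
  proof (rule inj_onI, clarify)
    fix a k a' k'
    assume m: "a \<in> totatives f" "k \<in> totatives d" "a' \<in> totatives f" "k' \<in> totatives d"
      and eq: "(a * d + k * f) mod (d * f) = (a' * d + k' * f) mod (d * f)"
    have lt: "a < f" "a' < f" "k < d" "k' < d" using m totatives_less assms by auto
    have c: "[a * d + k * f = a' * d + k' * f] (mod (d * f))"
      using eq by (simp only: unique_euclidean_semiring_class.cong_def)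
    have "[a * d + k * f = a' * d + k' * f] (mod f)" using c by (rule cong_dvd_modulus_nat) simp
    hence "[a * d = a' * d] (mod f)" by (simp add: unique_euclidean_semiring_class.cong_def)
    hence "[a = a'] (mod f)" using assms(3) by (simp add: cong_mult_rcancel_nat)
    hence 1: "a = a'" using lt by (simp add: unique_euclidean_semiring_class.cong_def)
    have "[a * d + k * f = a' * d + k' * f] (mod d)" using c by (rule cong_dvd_modulus_nat) simp
    hence "[k * f = k' * f] (mod d)" by (simp add: unique_euclidean_semiring_class.cong_def)
    hence "[k = k'] (mod d)" using assms(3) by (simp add: cong_mult_rcancel_nat coprime_commute)
    hence 2: "k = k'" using lt by (simp add: unique_euclidean_semiring_class.cong_def)
    show "a = a' \<and> k = k'" using 1 2 by simp
  qed
  have sub: "?h ` (totatives f \<times> totatives d) \<subseteq> totatives (d * f)"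
  proof clarify
    fix a k assume m: "a \<in> totatives f" "k \<in> totatives d"
    have "coprime (a * d) f" "coprime (k * f) d"
      using m assms(3) by (auto simp: in_totatives_iff coprime_commute)
    hence "coprime (a * d + k * f) f" "coprime (a * d + k * f) d"
      using cong_add_rcancel_0_nat coprime_cong_cong_left[of "a * d + k * f" "a * d" f]
         coprime_cong_cong_left[of "a * d + k * f" "k * f" d]
      by (simp_all add: unique_euclidean_semiring_class.cong_def)
    hence "coprime (a * d + k * f) (d * f)" by simp
    moreover have "[(a * d + k * f) mod (d * f) = a * d + k * f] (mod (d * f))"
      by (simp add: unique_euclidean_semiring_class.cong_def)
    ultimately have c: "coprime ((a * d + k * f) mod (d * f)) (d * f)"
      using coprime_cong_cong_left by blast
    moreover have "(a * d + k * f) mod (d * f) > 0" using c df by (intro Nat.gr0I) simp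
    moreover have "(a * d + k * f) mod (d * f) \<le> d * f" by (intro less_imp_le mod_less_divisor) (use df in linarith)
    ultimately show "(a * d + k * f) mod (d * f) \<in> totatives (d * f)" by (simp add: in_totatives_iff)
  qed
  \<comment> \<open>Surjectivity by counting: the injective image lies in the totatives, and
    \<open>totient\<close> is multiplicative on coprime arguments.\<close>
  have "card (?h ` (totatives f \<times> totatives d)) = totient f * totient d"
    using card_image[OF inj] by (simp add: card_cartesian_product totient_def)
  also have "\<dots> = card (totatives (d * f))"
    using totient_mult_coprime[OF assms(3)] by (simp add: totient_def)
  finally have "?h ` (totatives f \<times> totatives d) = totatives (d * f)"
    by (intro card_subset_eq sub) auto
  thus ?thesis using inj by (simp add: bij_betw_def)
qed

text \<open>Apply the cotangent formula with period d f. A residue b attached to (a, k) is congruent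
  to a d modulo f, so the character sees only \<open>\<psi> (int d) * \<psi> (int a)\<close>, and
  the sum over k collapses to \<open>cot_sum\<close>.\<close>

lemma L_at_1_induced:
  assumes d: "d > 1" and f: "f > 1" and cop: "coprime d f" and \<psi>: "\<psi> \<in> odd_characters f"
  shows "L_at_1 (induced_character (d * f) \<psi>) =
    of_real (pi / (2 * real (d * f))) * \<psi> (int d) *
      (\<Sum>a\<in>totatives f. \<psi> (int a) * of_real (cot_sum d (real a / real f)))"
proof -
  define N where "N = d * f"
  have N: "N > 1" using d f by (simp add: one_less_mult N_def)
  have dc: "dirichlet_character f \<psi>" and om: "\<psi> (- 1) = - 1" using \<psi> by (auto simp: odd_characters_def)
  define \<psi>' where "\<psi>' = induced_character N \<psi>"
  have "L_at_1 \<psi>' = of_real (pi / (2 * real N)) * (\<Sum>a<N. \<psi>' (int a) * of_real (cotpi (real a / real N)))"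
  proof (rule L_at_1_odd_periodic)
    show "N > 0" using N by simp
    fix a
    have "[a + int N = a] (mod int N)" "[a + int N = a] (mod int f)"
      by (auto simp: N_def cong_iff_dvd_diff)
    thus "\<psi>' (a + int N) = \<psi>' a"
      using coprime_cong_cong_left dirichlet_character_cong[OF dc] by (auto simp: \<psi>'_def induced_character_def)
    show "\<psi>' (- a) = - \<psi>' a"
      using dirichlet_character_mult[OF dc, of "-1" a] om by (simp add: \<psi>'_def induced_character_def)
  qed
  also have "(\<Sum>a<N. \<psi>' (int a) * of_real (cotpi (real a / real N))) =
     (\<Sum>b\<in>totatives N. \<psi> (int b) * of_real (cotpi (real b / real N)))"
  proof (rule sum.mono_neutral_cong_right)
    show "totatives N \<subseteq> {..<N}" using totatives_less N by auto
    show "\<forall>i\<in>{..<N} - totatives N. \<psi>' (int i) * of_real (cotpi (real i / real N)) = 0"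
    proof
      fix i assume i: "i \<in> {..<N} - totatives N"
      hence "i = 0 \<or> \<not> coprime i N" by (auto simp: in_totatives_iff)
      thus "\<psi>' (int i) * of_real (cotpi (real i / real N)) = 0"
        by (auto simp: \<psi>'_def induced_character_def cotpi_Ints)
    qed
  qed (auto simp: \<psi>'_def induced_character_def in_totatives_iff)
  also have "\<dots> = (\<Sum>(a, k)\<in>totatives f \<times> totatives d. \<psi> (int d) * (\<psi> (int a) * of_real (cotpi (real a / real f + real k / real d))))"
  proof -
    have "(\<Sum>b\<in>totatives N. \<psi> (int b) * of_real (cotpi (real b / real N))) =
       (\<Sum>p\<in>totatives f \<times> totatives d. (\<lambda>b. \<psi> (int b) * of_real (cotpi (real b / real N))) ((\<lambda>(a, k). (a * d + k * f) mod (d * f)) p))"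
      unfolding N_def
      by (rule sum.reindex_bij_betw[OF bij_betw_totatives_crt[OF d f cop], symmetric,
            where g = "\<lambda>b. \<psi> (int b) * of_real (cotpi (real b / real (d * f)))"])
    also have "\<dots> = (\<Sum>(a, k)\<in>totatives f \<times> totatives d. \<psi> (int d) * (\<psi> (int a) * of_real (cotpi (real a / real f + real k / real d))))"
    proof (rule sum.cong[OF refl], clarify)
      fix a k
      define b where "b = (a * d + k * f) mod (d * f)"
      have "[b = a * d + k * f] (mod N)" by (simp add: b_def N_def unique_euclidean_semiring_class.cong_def)
      hence c: "[int b = int (a * d + k * f)] (mod int N)" by (simp only: cong_int_iff)
      hence "[int b = int (a * d + k * f)] (mod int f)" by (rule cong_dvd_modulus) (simp add: N_def)
      also have "[int (a * d + k * f) = int d * int a] (mod int f)" by (simp add: cong_iff_dvd_diff)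
      finally have 1: "\<psi> (int b) = \<psi> (int d) * \<psi> (int a)"
        using dirichlet_character_cong[OF dc] dirichlet_character_mult[OF dc] by simp
      obtain j where "int (a * d + k * f) = int b + int N * j" using c unfolding cong_iff_lin by blast
      hence "real_of_int (int (a * d + k * f)) = real_of_int (int b + int N * j)" by (simp only:)
      hence "real (a * d + k * f) = real b + real N * real_of_int j" by simp
      hence "real (a * d + k * f) / real N = real b / real N + of_int j"
        using N by (simp add: add_divide_distrib)
      moreover have "real (a * d + k * f) / real N = real a / real f + real k / real d"
        using d f by (simp add: N_def field_simps)
      ultimately have 2: "cotpi (real a / real f + real k / real d) = cotpi (real b / real N)"
        using cotpi_add_int[of "real b / real N" j] by (simp only:)
      show "\<psi> (int b) * of_real (cotpi (real b / real N)) =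
        \<psi> (int d) * (\<psi> (int a) * of_real (cotpi (real a / real f + real k / real d)))"
        unfolding 1 2 by simp
    qed
    finally show ?thesis .
  qed
  also have "\<dots> = \<psi> (int d) * (\<Sum>a\<in>totatives f. \<psi> (int a) * of_real (cot_sum d (real a / real f)))"
    by (simp add: sum.cartesian_product [symmetric] sum_distrib_left [symmetric] cot_sum_def)
  finally show ?thesis by (simp add: \<psi>'_def N_def)
qed

text \<open>The factor \<open>\<psi> (int d)\<close> has absolute value 1 and drops out. The mean
  square then needs only that \<open>cot_sum\<close> is odd, with period 1.\<close>

lemma M_trivial_eq:
  assumes d: "d > 1" and f: "f > 2" and cop: "coprime d f"
  shows "M_trivial d f = pi\<^sup>2 / (2 * (real (d * f))\<^sup>2) * (\<Sum>a\<in>totatives f. (cot_sum d (real a / real f))\<^sup>2)"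
proof -
  define g where "g = (\<lambda>a. cot_sum d (real a / real f))"
  have godd: "g (f - a) = - g a" if "a \<in> totatives f" for a
  proof -
    have eq: "real (f - a) / real f = - (real a / real f) + of_int 1"
      using f totatives_le[OF that] by (simp add: of_nat_diff diff_divide_distrib)
    have per: "cot_sum d (y + of_int 1) = cot_sum d y" for y
    proof -
      have "y + of_int 1 + z = (y + z) + of_int 1" for z :: real by simp
      thus ?thesis unfolding cot_sum_def by (simp only: cotpi_add_int)
    qed
    show ?thesis unfolding g_def eq per by (rule cot_sum_minus[OF d])
  qed
  have L: "(cmod (L_at_1 (induced_character (d * f) \<psi>)))\<^sup>2 =
      (pi / (2 * real (d * f)))\<^sup>2 * (cmod (\<Sum>a\<in>totatives f. \<psi> (int a) * of_real (g a)))\<^sup>2"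
    if "\<psi> \<in> odd_characters f" for \<psi>
  proof -
    have "norm (\<psi> (int d)) = 1"
      by (rule norm_dirichlet_character[of f]) (use that f cop in \<open>auto simp: odd_characters_def\<close>)
    thus ?thesis using L_at_1_induced[OF d _ cop that] f
      by (simp add: norm_mult g_def power_mult_distrib norm_divide power_divide)
  qed
  have "M_trivial d f = (pi / (2 * real (d * f)))\<^sup>2 * (1 / real (card (odd_characters f)) *
     (\<Sum>\<psi>\<in>odd_characters f. (cmod (\<Sum>a\<in>totatives f. \<psi> (int a) * of_real (g a)))\<^sup>2))"
    by (simp add: M_trivial_def L sum_distrib_left [symmetric])
  \<comment> \<open>The factor 2 arises because orthogonality involves all characters, while the
    mean is over the odd half.\<close>
  also have "\<dots> = (pi / (2 * real (d * f)))\<^sup>2 * (2 * (\<Sum>a\<in>totatives f. (g a)\<^sup>2))"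
    using card_characters_eq(2)[OF f] by (subst mean_square_odd_characters[where g = g, OF f godd]) simp_all
  also have "\<dots> = pi\<^sup>2 / (2 * (real (d * f))\<^sup>2) * (\<Sum>a\<in>totatives f. (g a)\<^sup>2)"
    by (simp add: power_divide power_mult_distrib)
  finally show ?thesis by (simp add: g_def)
qed

section \<open>Signs modulo d and assembly of the formula\<close>

text \<open>The bound d > 2 separates the classes of 1 and -1, so the first branch of
  \<open>eps\<close> cannot capture the second class.\<close>

lemma eps_eqI:
  assumes "d > 2" "e = 1 \<or> e = - 1" "[n = e] (mod int d)"
  shows "eps d n = of_int e"
proof (cases "e = 1")
  case False
  hence e: "e = - 1" using assms(2) by simp
  have "\<not> [n = 1] (mod int d)"
  proof
    assume "[n = 1] (mod int d)"
    hence "[1 = - 1] (mod int d)" using assms(3) e by (metis cong_sym cong_trans)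
    hence "int d dvd 1 - (- 1)" by (simp only: cong_iff_dvd_diff)
    hence "int d dvd 2" by simp
    hence "int d \<le> 2" by (rule zdvd_imp_le) simp
    thus False using assms(1) by simp
  qed
  thus ?thesis using assms(3) e by (simp add: eps_def)
qed (use assms in \<open>simp add: eps_def\<close>)

text \<open>The classes +-1 are closed under multiplication. This carries the hypothesis from the
  primes to every divisor of f, where the sieve uses the closed form.\<close>

lemma cong_pm1_of_prime_factors:
  fixes m d :: nat
  assumes "m > 0" "\<forall>q\<in>prime_factors m. [int q = 1] (mod int d) \<or> [int q = - 1] (mod int d)"
  shows "\<exists>e. (e = 1 \<or> e = - 1) \<and> [int m = e] (mod int d)"
  using assms
proof (induction m rule: prime_divisors_induct)
  case (unit m)
  thus ?case by (intro exI[of _ 1]) auto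
next
  case (factor p m)
  hence m: "m > 0" by simp
  have "\<forall>q\<in>prime_factors m. [int q = 1] (mod int d) \<or> [int q = - 1] (mod int d)"
    using factor.prems m by (auto simp: in_prime_factors_iff)
  then obtain e where e: "e = 1 \<or> e = - 1" "[int m = e] (mod int d)" using factor.IH m by blast
  have "p \<in> prime_factors (p * m)" using factor.hyps factor.prems by (auto simp: in_prime_factors_iff)
  then obtain e' where e': "e' = 1 \<or> e' = - 1" "[int p = e'] (mod int d)" using factor.prems by blast
  have "[int (p * m) = e' * e] (mod int d)" using cong_mult[OF e'(2) e(2)] by simp
  moreover have "e' * e = 1 \<or> e' * e = - 1" using e(1) e'(1) by auto
  ultimately show ?case by blast
qed auto

lemma M_trivial_formula:
  assumes d: "d > 2" and f: "f > 2"
    and pf: "\<forall>q\<in>prime_factors f. [int q = 1] (mod int d) \<or> [int q = - 1] (mod int d)"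
  shows "M_trivial d f = kappa d *
          ((\<Prod>q\<in>prime_factors f. (1 - 1 / (real q)\<^sup>2))
           - c_const d / real f * (\<Prod>q\<in>prime_factors f. (1 - 1 / real q))
           + eps d (int f) * ((c_const d - 1) / real f)
               * (\<Prod>q\<in>prime_factors f. (1 - eps d (int q) / real q)))"
proof -
  define J where "J = (\<Sum>k\<in>totatives d. 1 / (sin (pi * (real k / real d)))\<^sup>2)"
  define \<phi> where "\<phi> = real (totient d)"
  have cls: "\<exists>e. (e = 1 \<or> e = - 1) \<and> [int m = e] (mod int d)" if "m dvd f" for m
  proof (rule cong_pm1_of_prime_factors)
    show "m > 0" using that f by (auto intro: Nat.gr0I)
    show "\<forall>q\<in>prime_factors m. [int q = 1] (mod int d) \<or> [int q = - 1] (mod int d)"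
    proof
      fix q assume "q \<in> prime_factors m"
      hence "prime q" "q dvd f" using dvd_trans[OF _ that] by auto
      hence "q \<in> prime_factors f" using f by (simp add: in_prime_factors_iff)
      thus "[int q = 1] (mod int d) \<or> [int q = - 1] (mod int d)" using pf by blast
    qed
  qed
  have cop: "coprime d f"
  proof -
    obtain e where "e = 1 \<or> e = - 1" "[int f = e] (mod int d)" using cls[of f] by auto
    hence "coprime (int f) (int d)" using coprime_cong_cong_left by force
    thus ?thesis by (simp add: coprime_commute)
  qed
  define h :: "nat \<Rightarrow> nat \<Rightarrow> real" where
    "h = (\<lambda>s m. if s = 0 then (real m)\<^sup>2 else if s = 1 then real m else eps d (int m) * real m)"
  \<comment> \<open>The coefficients of F^2, F and eps(F) F in
    \<open>sum_cot_sum_sq\<close>.\<close>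
  define c :: "nat \<Rightarrow> real" where "c = (\<lambda>s. if s = 0 then J else if s = 1 then - \<phi>\<^sup>2 else \<phi>\<^sup>2 - J)"
  \<comment> \<open>A sign is its own inverse; this brings the sieve factor 1 - 1 / (eps(q) q) into
    the form of the statement.\<close>
  have eps2: "1 / (eps d (int q) * real q) = eps d (int q) / real q" if "q dvd f" for q
  proof -
    obtain e where "e = 1 \<or> e = - 1" "[int q = e] (mod int d)" using cls[of q] \<open>q dvd f\<close> by auto
    thus ?thesis using eps_eqI[OF d, of e "int q"] by auto
  qed
  have "(\<Sum>a\<in>totatives f. (cot_sum d (real a / real f))\<^sup>2) =
    (\<Sum>s\<in>{0,1,2}. c s * (h s f * (\<Prod>q\<in>prime_factors f. 1 - 1 / h s q)))"
  proof (rule sum_totatives[where g = "\<lambda>y. (cot_sum d y)\<^sup>2"])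
    show "f > 1" using f by simp
  next
    fix m assume m: "m dvd f"
    hence m0: "m > 0" using f by (auto intro: Nat.gr0I)
    obtain e where e: "e = 1 \<or> e = - 1" "[int m = e] (mod int d)" using cls[OF m] by auto
    show "(\<Sum>a<m. (cot_sum d (real a / real m))\<^sup>2) = (\<Sum>s\<in>{0,1,2}. c s * h s m)"
      using sum_cot_sum_sq[OF m0 _ e, folded J_def \<phi>_def] eps_eqI[OF d e] d
      by (simp add: c_def h_def algebra_simps)
  next
    fix s p m :: nat assume s: "s \<in> {0,1,2}" and p: "prime p" and pm: "p * m dvd f"
    have "p dvd f" "m dvd f" using pm by (auto dest: dvd_mult_left dvd_mult_right)
    then obtain e e' where e: "e = 1 \<or> e = - 1" "[int p = e] (mod int d)"
      and e': "e' = 1 \<or> e' = - 1" "[int m = e'] (mod int d)" using cls by meson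
    have "[int (p * m) = e * e'] (mod int d)" using cong_mult[OF e(2) e'(2)] by simp
    moreover have "e * e' = 1 \<or> e * e' = - 1" using e(1) e'(1) by auto
    ultimately have "eps d (int (p * m)) = of_int (e * e')" by (intro eps_eqI[OF d])
    hence "eps d (int (p * m)) = eps d (int p) * eps d (int m)"
      using eps_eqI[OF d e] eps_eqI[OF d e'] by simp
    thus "h s (p * m) = h s p * h s m" by (simp add: h_def power_mult_distrib)
  next
    fix s p :: nat assume s: "s \<in> {0,1,2}" and p: "p \<in> prime_factors f"
    hence p': "prime p" "p dvd f" by auto
    obtain e where e: "e = 1 \<or> e = - 1" "[int p = e] (mod int d)" using cls[OF p'(2)] by auto
    show "h s p \<noteq> 0" using eps_eqI[OF d e] e(1) p'(1) by (auto simp: h_def)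
  qed
  also have "\<dots> = J * ((real f)\<^sup>2 * (\<Prod>q\<in>prime_factors f. 1 - 1 / (real q)\<^sup>2))
     - \<phi>\<^sup>2 * (real f * (\<Prod>q\<in>prime_factors f. 1 - 1 / real q))
     + (\<phi>\<^sup>2 - J) * (eps d (int f) * real f * (\<Prod>q\<in>prime_factors f. 1 - eps d (int q) / real q))"
  proof -
    have "(\<Prod>q\<in>prime_factors f. 1 - 1 / (eps d (int q) * real q)) = (\<Prod>q\<in>prime_factors f. 1 - eps d (int q) / real q)"
      by (intro prod.cong refl) (simp add: eps2 in_prime_factors_iff)
    thus ?thesis by (simp add: c_def h_def)
  qed
  finally have S: "(\<Sum>a\<in>totatives f. (cot_sum d (real a / real f))\<^sup>2) = \<dots>" .
  \<comment> \<open>J is d^2 / 3 times the Euler product in \<open>kappa\<close>, and pi^2 / (2 d^2)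
    times d^2 / 3 is pi^2 / 6.\<close>
  have kap: "kappa d = pi\<^sup>2 / (2 * (real d)\<^sup>2) * J"
    using sum_inverse_sin_sq_totatives[of d] d by (simp add: kappa_def J_def field_simps)
  \<comment> \<open>The 3 in \<open>c_const\<close> cancels the 1/3 in J. At each prime, (1 - 1/q^2)
    (q - 1) / (q + 1) = (1 - 1/q)^2, so the product is (phi / d)^2.\<close>
  have kc: "kappa d * c_const d = pi\<^sup>2 / (2 * (real d)\<^sup>2) * \<phi>\<^sup>2"
  proof -
    have "(\<Prod>q\<in>prime_factors d. 1 - 1 / (real q)\<^sup>2) * (\<Prod>q\<in>prime_factors d. (real q - 1) / (real q + 1))
       = (\<Prod>q\<in>prime_factors d. (1 - 1 / real q)\<^sup>2)"
      unfolding prod.distrib [symmetric]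
    proof (rule prod.cong[OF refl])
      fix q assume "q \<in> prime_factors d"
      hence "real q > 0" by (auto simp: in_prime_factors_iff prime_gt_0_nat)
      thus "(1 - 1 / (real q)\<^sup>2) * ((real q - 1) / (real q + 1)) = (1 - 1 / real q)\<^sup>2"
        by (simp add: divide_simps) (simp add: power2_eq_square algebra_simps)
    qed
    also have "\<dots> = (\<phi> / real d)\<^sup>2"
      using totient_formula2[of d] d by (simp add: \<phi>_def prod_power_distrib)
    finally have *: "(\<Prod>q\<in>prime_factors d. 1 - 1 / (real q)\<^sup>2) * (\<Prod>q\<in>prime_factors d. (real q - 1) / (real q + 1))
       = (\<phi> / real d)\<^sup>2" .
    have "kappa d * c_const d = pi\<^sup>2 / 2 * ((\<Prod>q\<in>prime_factors d. 1 - 1 / (real q)\<^sup>2) * (\<Prod>q\<in>prime_factors d. (real q - 1) / (real q + 1)))"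
      by (simp add: kappa_def c_const_def)
    thus ?thesis unfolding * by (simp add: power_divide)
  qed
  define P0 P1 P2 where "P0 = (\<Prod>q\<in>prime_factors f. 1 - 1 / (real q)\<^sup>2)"
    and "P1 = (\<Prod>q\<in>prime_factors f. 1 - 1 / real q)"
    and "P2 = eps d (int f) * (\<Prod>q\<in>prime_factors f. 1 - eps d (int q) / real q)"
  define K where "K = pi\<^sup>2 / (2 * (real d)\<^sup>2)"
  have "M_trivial d f = pi\<^sup>2 / (2 * (real (d * f))\<^sup>2) *
     (J * ((real f)\<^sup>2 * P0) - \<phi>\<^sup>2 * (real f * P1) + (\<phi>\<^sup>2 - J) * (real f * P2))"
    using M_trivial_eq[OF _ f cop] d S by (simp add: P0_def P1_def P2_def mult_ac)
  also have "\<dots> = (K / (real f)\<^sup>2) * 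
     (J * ((real f)\<^sup>2 * P0) - \<phi>\<^sup>2 * (real f * P1) + (\<phi>\<^sup>2 - J) * (real f * P2))"
    by (simp add: K_def power_mult_distrib)
  also have "\<dots> = (K * J) * P0 - (K * \<phi>\<^sup>2) / real f * P1 + (K * \<phi>\<^sup>2 - K * J) / real f * P2"
    using f by (simp add: field_simps power2_eq_square)
  also have "\<dots> = kappa d * (P0 - c_const d / real f * P1 + (c_const d - 1) / real f * P2)"
    unfolding K_def kap [symmetric] kc [symmetric] by (simp add: field_simps)
  finally show ?thesis by (simp add: P0_def P1_def P2_def mult_ac)
qed

theorem theorem4p1:
  fixes d0 :: nat
  assumes "d0 > 2" and "squarefree d0"
  shows
    "(\<forall>f::nat. f > 2 \<longrightarrow>
        (\<forall>q\<in>prime_factors f. [int q = 1] (mod int d0) \<or> [int q = - 1] (mod int d0)) \<longrightarrow>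
        M_trivial d0 f = kappa d0 *
          ((\<Prod>q\<in>prime_factors f. (1 - 1 / (real q)\<^sup>2))
           - c_const d0 / real f * (\<Prod>q\<in>prime_factors f. (1 - 1 / real q))
           + eps d0 (int f) * ((c_const d0 - 1) / real f)
               * (\<Prod>q\<in>prime_factors f. (1 - eps d0 (int q) / real q)))) \<and>
     (\<forall>f::nat. f > 2 \<longrightarrow>
        (\<forall>q\<in>prime_factors f. [int q = 1] (mod int d0)) \<longrightarrow>
        M_trivial d0 f = kappa d0 *
          ((\<Prod>q\<in>prime_factors f. (1 - 1 / (real q)\<^sup>2))
           - 1 / real f * (\<Prod>q\<in>prime_factors f. (1 - 1 / real q))))"
proof (intro conjI allI impI)
  fix f :: nat assume f: "f > 2" "\<forall>q\<in>prime_factors f. [int q = 1] (mod int d0)"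
  have e1: "eps d0 (int q) = 1" if "q \<in> prime_factors f" for q
    using f(2) that by (simp add: eps_def)
  have "[int f = 1] (mod int d0)"
  proof -
    have "[int (\<Prod>p\<in>prime_factors f. p ^ multiplicity p f) = (\<Prod>p\<in>prime_factors f. 1)] (mod int d0)"
      unfolding of_nat_prod of_nat_power
    proof (rule cong_prod)
      fix p assume "p \<in> prime_factors f"
      hence "[int p = 1] (mod int d0)" using f(2) by blast
      from cong_pow[OF this] show "[int p ^ multiplicity p f = 1] (mod int d0)" by simp
    qed
    thus ?thesis using f(1) prime_factorization_nat[of f] by simp
  qed
  hence ef: "eps d0 (int f) = 1" by (simp add: eps_def)
  \<comment> \<open>With all signs equal to 1 the last two products coincide, and -c / f + (c - 1) /
    f = -1 / f.\<close>
  have "(\<Prod>q\<in>prime_factors f. (1 - eps d0 (int q) / real q)) = (\<Prod>q\<in>prime_factors f. (1 - 1 / real q))"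
    by (intro prod.cong refl) (simp add: e1)
  with M_trivial_formula[OF assms(1) f(1)] f(2) ef
  show "M_trivial d0 f = kappa d0 *
          ((\<Prod>q\<in>prime_factors f. (1 - 1 / (real q)\<^sup>2))
           - 1 / real f * (\<Prod>q\<in>prime_factors f. (1 - 1 / real q)))"
    by (simp add: diff_divide_distrib left_diff_distrib)
qed (rule M_trivial_formula[OF assms(1)])

end
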